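(* Assume the standing diffusion and cost conditions described in the context. Then there exists a pair $(y_*,z_* )\in\mathcal R$ such that $$F(y_*,z_* )=F_*:=\inf\{F(y,z):(y,z)\in\mathcal R\}.$$ Furthermore, when $c_1\in C^1(\mathcal R)$, an optimizing pair $(y_*,z_* )$ satisfies the following first-order conditions: (a) When $a$ is a natural boundary, $$F_*=\frac{-\frac{\partial c_1}{\partial y}(y_*,z_* )+g_0'(y_* )}{\zeta'(y_* )}=\frac{\frac{\partial c_1}{\partial z}(y_*,z_* )+g_0'(z_* )}{\zeta'(z_* )}.\qquad(\ast)$$ (b) When $a$ is an attainable boundary (regular or exit), an optimal pair may have $y_*=a$. When $y_*\ne a$, $(\ast)$ holds; when $y_*=a$, $$\frac{-\frac{\partial c_1}{\partial y}(a,z_* )+g_0'(a)}{\zeta'(a)}\le F_*=\frac{\frac{\partial c_1}{\partial z}(a,z_* )+g_0'(z_* )}{\zeta'(z_* )}.$$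
   Context: Diffusion. Let $\mathcal I=(a,b)$ with $-\infty\le a<b\le\infty$, let $\mu,\sigma$ be continuous on $\mathcal I$ with $\sigma^2>0$, and consider the regular diffusion $dX_0(t)=\mu(X_0(t))\,dt+\sigma(X_0(t))\,dW(t)$ on $\mathcal I$, $X_0(0)=x_0\in\mathcal I$, $W$ a standard Brownian motion. Scale density $s(x)=\exp(-\int^x 2\mu(v)/\sigma^2(v)\,dv)$, scale function $S(x)=\int^x s(v)\,dv$, scale measure $S[y,z]=S(z)-S(y)$, speed density $m(x)=1/(\sigma^2(x)s(x))$, speed measure $M[y,z]=\int_y^z m(v)\,dv$; half-open versions such as $S(a,x]$, $M[y,b)$ are limits. Diffusion condition: $a$ is attracting ($S(a,x]<\infty$) and $b$ is non-attracting ($S[x,b)=\infty$) for $x\in\mathcal I$. Boundary classification: $a$ is attainable if $\int_a^x M[u,x]\,dS(u)<\infty$ (then regular if $M(a,x]<\infty$ and exit if $M(a,x]=\infty$), and natural otherwise; $b$ is entrance if $\int_y^b M[u,b)\,dS(u)<\infty$, and natural otherwise. If $a$ is regular its boundary behavior is specified as reflective or sticky. If $a=-\infty$ or $b=\infty$, that boundary is required to be natural. $\mathcal E$ is $\mathcal I$ together with $a$ if $a$ is attainable and together with $b$ if $b$ is entrance. $\mathcal R=\{(y,z)\in\mathcal E^2:y<z\}$, $\overline{\mathcal R}=\{(y,z)\in\mathcal E^2:y\le z\}$. Cost conditions: (a) $c_0:\mathcal I\to\mathbb R^+$ is continuous and inf-compact ($\{x\in\mathcal I:c_0(x)\le L\}$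 is compact for every $L>0$); if $a\in\mathcal E$ then $\lim_{x\to a}c_0(x)=\infty$, and if $b\in\mathcal E$ then $\lim_{x\to b}c_0(x)=\infty$; for each $y\in\mathcal I$, $\int_y^b c_0\,dM<\infty$ and $\int_y^b\int_u^b c_0(v)\,dM(v)\,dS(u)=\infty$. (b) $c_1:\overline{\mathcal R}\to\mathbb R^+$ is continuous with $c_1\ge k_1$ for a constant $k_1>0$; $c_1(y,z)\ge c_1(z,z)$ for $y\le z$ in $\mathcal I$; and $c_1(w,z)+c_1(x,y)=c_1(w,y)+c_1(x,z)$ for $w\le x\le y\le z$ in $\mathcal I$. Functions. Fix $C\in\mathcal I$. On $\mathcal E$ set $g_0(x)=\int_C^x\int_u^b 2c_0(v)\,dM(v)\,dS(u)$ and $\zeta(x)=2\int_C^x M[u,b)\,dS(u)$. For $(y,z)\in\mathcal R$ and a function $f$, $Bf(y,z)=f(z)-f(y)$, and $$F(y,z)=\frac{c_1(y,z)+Bg_0(y,z)}{B\zeta(y,z)}.$$ *)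

theory Defs
  imports "HOL-Analysis.Analysis"
begin

section \<open>Scale and speed of the diffusion\<close>

text \<open>
  The data of the diffusion \<open>dX = \<mu>(X) dt + \<sigma>(X) dW\<close> on the interval \<open>(lower, upper)\<close>.
  The field \<open>base\<close> is the unspecified lower limit of the indefinite integrals that define the
  scale density and the scale function.
\<close>

record diffusion =
  lower :: ereal
  upper :: ereal
  drift :: "real \<Rightarrow> real"
  dispersion :: "real \<Rightarrow> real"
  base :: real

definition state :: "diffusion \<Rightarrow> real set" where
  "state D = einterval (lower D) (upper D)"

definition scale_density :: "diffusion \<Rightarrow> real \<Rightarrow> real" where
  "scale_density D x = exp (- (LBINT v=base D..x. 2 * drift D v / (dispersion D v)\<^sup>2))"

definition scale_function :: "diffusion \<Rightarrow> real \<Rightarrow> real" where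
  "scale_function D x = (LBINT v=base D..x. scale_density D v)"

definition speed_density :: "diffusion \<Rightarrow> real \<Rightarrow> real" where
  "speed_density D x = 1 / ((dispersion D x)\<^sup>2 * scale_density D x)"

text \<open>
  Both measures are concentrated on the open state interval and have no atoms.
  Hence \<open>S(a,x]\<close> is \<open>emeasure (scale_measure D) {..x}\<close> and \<open>M[y,b)\<close> is
  \<open>emeasure (speed_measure D) {y..}\<close>; by continuity of measures these are the limits of the
  measures of compact subintervals. Likewise an integral from \<open>a\<close> to \<open>x\<close> is one over \<open>{..x}\<close>,
  and an integral from \<open>y\<close> to \<open>b\<close> is one over \<open>{y..}\<close>.
\<close>

definition scale_measure :: "diffusion \<Rightarrow> real measure" where
  "scale_measure D =
     density lborel (\<lambda>x. ennreal (scale_density D x) * indicator (state D) x)"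

definition speed_measure :: "diffusion \<Rightarrow> real measure" where
  "speed_measure D =
     density lborel (\<lambda>x. ennreal (speed_density D x) * indicator (state D) x)"


section \<open>Boundary classification and the state space\<close>

definition lower_attracting :: "diffusion \<Rightarrow> bool" where
  "lower_attracting D \<longleftrightarrow> (\<forall>x\<in>state D. emeasure (scale_measure D) {..x} < \<infinity>)"

definition lower_attainable :: "diffusion \<Rightarrow> bool" where
  "lower_attainable D \<longleftrightarrow>
     (\<forall>x\<in>state D. (\<integral>\<^sup>+u\<in>{..x}. emeasure (speed_measure D) {u..x} \<partial>scale_measure D) < \<infinity>)"

definition lower_natural :: "diffusion \<Rightarrow> bool" where
  "lower_natural D \<longleftrightarrow> \<not> lower_attainable D"

definition upper_entrance :: "diffusion \<Rightarrow> bool" where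
  "upper_entrance D \<longleftrightarrow>
     (\<forall>y\<in>state D. (\<integral>\<^sup>+u\<in>{y..}. emeasure (speed_measure D) {u..} \<partial>scale_measure D) < \<infinity>)"

definition upper_natural :: "diffusion \<Rightarrow> bool" where
  "upper_natural D \<longleftrightarrow> \<not> upper_entrance D"

definition diffusion_condition :: "diffusion \<Rightarrow> bool" where
  "diffusion_condition D \<longleftrightarrow>
     lower D < upper D \<and>
     base D \<in> state D \<and>
     continuous_on (state D) (drift D) \<and>
     continuous_on (state D) (dispersion D) \<and>
     (\<forall>x\<in>state D. (dispersion D x)\<^sup>2 > 0) \<and>
     lower_attracting D \<and>
     (\<forall>x\<in>state D. emeasure (scale_measure D) {x..} = \<infinity>) \<and>
     (lower D = -\<infinity> \<longrightarrow> lower_natural D) \<and>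
     (upper D = \<infinity> \<longrightarrow> upper_natural D)"

text \<open>
  Infinite boundaries are natural, so adjoining the attainable or entrance boundaries to the
  state interval stays within the reals.
\<close>

definition estate :: "diffusion \<Rightarrow> real set" where
  "estate D = state D \<union> {x. ereal x = lower D \<and> lower_attainable D}
                      \<union> {x. ereal x = upper D \<and> upper_entrance D}"

definition R_set :: "diffusion \<Rightarrow> (real \<times> real) set" where
  "R_set D = {(y, z). y \<in> estate D \<and> z \<in> estate D \<and> y < z}"

definition Rbar_set :: "diffusion \<Rightarrow> (real \<times> real) set" where
  "Rbar_set D = {(y, z). y \<in> estate D \<and> z \<in> estate D \<and> y \<le> z}"


section \<open>Costs\<close>

definition holding_cost_condition :: "diffusion \<Rightarrow> (real \<Rightarrow> real) \<Rightarrow> bool" where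
  "holding_cost_condition D c0 \<longleftrightarrow>
     (\<forall>x\<in>state D. 0 \<le> c0 x) \<and>
     continuous_on (state D) c0 \<and>
     (\<forall>L>0. compact {x\<in>state D. c0 x \<le> L}) \<and>
     (\<forall>x\<in>estate D. ereal x = lower D \<longrightarrow> filterlim c0 at_top (at_right x)) \<and>
     (\<forall>x\<in>estate D. ereal x = upper D \<longrightarrow> filterlim c0 at_top (at_left x)) \<and>
     (\<forall>y\<in>state D. (\<integral>\<^sup>+v\<in>{y..}. ennreal (c0 v) \<partial>speed_measure D) < \<infinity>) \<and>
     (\<forall>y\<in>state D.
        (\<integral>\<^sup>+u\<in>{y..}. (\<integral>\<^sup>+v\<in>{u..}. ennreal (c0 v) \<partial>speed_measure D) \<partial>scale_measure D) = \<infinity>)"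

definition ordering_cost_condition :: "diffusion \<Rightarrow> (real \<times> real \<Rightarrow> real) \<Rightarrow> bool" where
  "ordering_cost_condition D c1 \<longleftrightarrow>
     continuous_on (Rbar_set D) c1 \<and>
     (\<exists>k1>0. \<forall>p\<in>Rbar_set D. k1 \<le> c1 p) \<and>
     (\<forall>y\<in>state D. \<forall>z\<in>state D. y \<le> z \<longrightarrow> c1 (z, z) \<le> c1 (y, z)) \<and>
     (\<forall>w\<in>state D. \<forall>x\<in>state D. \<forall>y\<in>state D. \<forall>z\<in>state D. w \<le> x \<and> x \<le> y \<and> y \<le> z \<longrightarrow>
        c1 (w, z) + c1 (x, y) = c1 (w, y) + c1 (x, z))"

text \<open>
  The function \<open>c1\<close> is continuously differentiable on the set of pairs, with partial derivatives
  \<open>c1y\<close> and \<open>c1z\<close>. The derivatives are taken within the sections of that set: they are ordinary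
  derivatives at points of the open state interval and one-sided ones at an adjoined boundary.
\<close>

definition C1_with_partials ::
  "diffusion \<Rightarrow> (real \<times> real \<Rightarrow> real) \<Rightarrow> (real \<times> real \<Rightarrow> real) \<Rightarrow> (real \<times> real \<Rightarrow> real) \<Rightarrow> bool"
where
  "C1_with_partials D c1 c1y c1z \<longleftrightarrow>
     continuous_on (R_set D) c1y \<and> continuous_on (R_set D) c1z \<and>
     (\<forall>(y, z)\<in>R_set D.
        ((\<lambda>u. c1 (u, z)) has_real_derivative c1y (y, z)) (at y within {u. (u, z) \<in> R_set D}) \<and>
        ((\<lambda>u. c1 (y, u)) has_real_derivative c1z (y, z)) (at z within {u. (y, u) \<in> R_set D}))"


section \<open>The long-term average cost functional\<close>

definition oriented_integral :: "diffusion \<Rightarrow> real \<Rightarrow> real \<Rightarrow> (real \<Rightarrow> ennreal) \<Rightarrow> ereal" where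
  "oriented_integral D C x f =
     (if C \<le> x then enn2ereal (\<integral>\<^sup>+u\<in>{C..x}. f u \<partial>scale_measure D)
      else - enn2ereal (\<integral>\<^sup>+u\<in>{x..C}. f u \<partial>scale_measure D))"

text \<open>
  \<open>g0\<close> is extended real valued: it is \<open>\<infinity>\<close> at an entrance boundary \<open>b\<close> and may be \<open>-\<infinity>\<close> at an
  attainable boundary \<open>a\<close>; \<open>\<zeta>\<close> is finite on \<open>estate D\<close>. Hence the increment of \<open>g0\<close> in \<open>F\<close> is
  never of the form \<open>\<infinity> - \<infinity>\<close>, and \<open>F\<close> takes values in \<open>(0, \<infinity>]\<close>.
\<close>

definition g0 :: "diffusion \<Rightarrow> (real \<Rightarrow> real) \<Rightarrow> real \<Rightarrow> real \<Rightarrow> ereal" where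
  "g0 D c0 C x =
     oriented_integral D C x (\<lambda>u. \<integral>\<^sup>+v\<in>{u..}. ennreal (2 * c0 v) \<partial>speed_measure D)"

definition zeta :: "diffusion \<Rightarrow> real \<Rightarrow> real \<Rightarrow> ereal" where
  "zeta D C x = 2 * oriented_integral D C x (\<lambda>u. emeasure (speed_measure D) {u..})"

definition incr :: "(real \<Rightarrow> ereal) \<Rightarrow> real \<times> real \<Rightarrow> ereal" where
  "incr f = (\<lambda>(y, z). f z - f y)"

definition cost_F ::
  "diffusion \<Rightarrow> (real \<Rightarrow> real) \<Rightarrow> (real \<times> real \<Rightarrow> real) \<Rightarrow> real \<Rightarrow> real \<times> real \<Rightarrow> ereal"
where
  "cost_F D c0 c1 C p = (ereal (c1 p) + incr (g0 D c0 C) p) / incr (zeta D C) p"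

definition F_star ::
  "diffusion \<Rightarrow> (real \<Rightarrow> real) \<Rightarrow> (real \<times> real \<Rightarrow> real) \<Rightarrow> real \<Rightarrow> ereal"
where
  "F_star D c0 c1 C = (INF p\<in>R_set D. cost_F D c0 c1 C p)"


section \<open>Derivatives of the extended real valued functions\<close>

text \<open>The ordinary derivative, to be used at points near which the function is finite.\<close>

definition ederiv :: "(real \<Rightarrow> ereal) \<Rightarrow> real \<Rightarrow> real" where
  "ederiv f x = deriv (\<lambda>u. real_of_ereal (f u)) x"

text \<open>
  The one-sided derivative at the left boundary, with infinite values admitted. Since the scale
  density may oscillate, vanish or blow up at an attainable boundary \<open>a\<close>, the derivatives of \<open>g0\<close>
  and \<open>\<zeta>\<close> at \<open>a\<close> need not exist, and their quotient may be indeterminate. The boundary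
  inequality is therefore stated both with the one-sided derivatives, whenever these exist and
  the quotient is determinate, and, without any proviso, with the lower limit at \<open>a\<close> of the
  quotient of the interior derivatives.
\<close>

definition has_right_ederiv :: "(real \<Rightarrow> ereal) \<Rightarrow> ereal \<Rightarrow> real \<Rightarrow> bool" where
  "has_right_ederiv f d x \<longleftrightarrow> ((\<lambda>u. (f u - f x) / ereal (u - x)) \<longlongrightarrow> d) (at_right x)"


section \<open>The measures agree with the increments of their distribution functions\<close>

lemma Icc_subset_state: "y \<in> state D \<Longrightarrow> z \<in> state D \<Longrightarrow> {y..z} \<subseteq> state D"
  unfolding state_def einterval_iff subset_iff
  by (metis atLeastAtMost_iff ereal_less_eq(3) order.strict_trans1 order.strict_trans2)

lemma has_derivative_indefinite_integral:
  assumes f: "continuous_on (state D) f" and r: "r \<in> state D" and x: "x \<in> state D"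
  shows "((\<lambda>u. LBINT v=ereal r..ereal u. f v) has_real_derivative f x) (at x)"
proof -
  have op: "open (state D)" unfolding state_def by simp
  obtain e where e: "e > 0" "cball x e \<subseteq> state D"
    using op x open_contains_cball by blast
  define p where "p = min r (x - e)"
  define q where "q = max r (x + e)"
  have "x - e \<in> state D" "x + e \<in> state D"
    using e by (auto simp: subset_iff dist_real_def)
  then have "p \<in> state D" "q \<in> state D"
    using r by (auto simp: p_def q_def min_def max_def)
  then have "{p..q} \<subseteq> state D" by (rule Icc_subset_state)
  then have c: "continuous_on {p..q} f" using f continuous_on_subset by blast
  have pq: "p \<le> r" "r \<le> q" "p < x" "x < q"
    using e by (auto simp: p_def q_def)
  have "((\<lambda>u. LBINT v=ereal r..ereal u. f v) has_vector_derivative f x) (at x within {p..q})"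
    using interval_integral_FTC2[OF pq(1,2) c, of x] pq by simp
  moreover have "at x within {p..q} = at x"
    using pq by (simp add: at_within_Icc_at)
  ultimately show ?thesis
    by (simp add: has_real_derivative_iff_has_vector_derivative)
qed

lemma continuous_on_scale_density:
  assumes "diffusion_condition D"
  shows "continuous_on (state D) (scale_density D)"
proof -
  let ?f = "\<lambda>v. 2 * drift D v / (dispersion D v)\<^sup>2"
  have f: "continuous_on (state D) ?f"
    using assms unfolding diffusion_condition_def by (intro continuous_intros) auto
  have r: "base D \<in> state D" using assms unfolding diffusion_condition_def by simp
  have "isCont (\<lambda>u. LBINT v=ereal (base D)..ereal u. ?f v) x" if "x \<in> state D" for x
    using has_derivative_indefinite_integral[OF f r that] DERIV_isCont by blast
  then have "continuous_on (state D) (\<lambda>u. LBINT v=ereal (base D)..ereal u. ?f v)"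
    by (simp add: continuous_at_imp_continuous_on)
  then show ?thesis
    unfolding scale_density_def by (intro continuous_intros)
qed

lemma emeasure_density_Icc:
  assumes f: "continuous_on (state D) f" "\<And>x. 0 \<le> f x"
    and F: "\<And>x. x \<in> state D \<Longrightarrow> (F has_real_derivative f x) (at x)"
    and yz: "y \<in> state D" "z \<in> state D" "y \<le> z"
  shows "emeasure (density lborel (\<lambda>x. ennreal (f x) * indicator (state D) x)) {y..z}
       = ennreal (F z - F y)"
proof -
  have op: "open (state D)" unfolding state_def by simp
  have sub: "{y..z} \<subseteq> state D" using yz by (intro Icc_subset_state)
  have m: "(\<lambda>x. indicator (state D) x *\<^sub>R f x) \<in> borel_measurable borel"
    by (rule borel_measurable_continuous_on_indicator[OF _ f(1)]) (use op in auto)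
  have eq: "(\<lambda>x. ennreal (f x) * indicator (state D) x)
          = (\<lambda>x. ennreal (indicator (state D) x *\<^sub>R f x))"
    by (auto simp: indicator_def)
  have "emeasure (density lborel (\<lambda>x. ennreal (f x) * indicator (state D) x)) {y..z}
      = (\<integral>\<^sup>+x. ennreal (indicator (state D) x *\<^sub>R f x) * indicator {y..z} x \<partial>lborel)"
    unfolding eq using m by (subst emeasure_density) auto
  also have "\<dots> = ennreal (F z - F y)"
  proof (rule nn_integral_FTC_Icc[OF m])
    fix x assume "x \<in> {y..z}"
    then have xs: "x \<in> state D" using sub by blast
    show "(F has_real_derivative indicator (state D) x *\<^sub>R f x) (at x)"
      using F[OF xs] xs by simp
    show "0 \<le> indicator (state D) x *\<^sub>R f x" using f(2) by simp
  qed (rule yz(3))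
  finally show ?thesis .
qed

lemma emeasure_scale_measure_Icc:
  assumes D: "diffusion_condition D" and "y \<in> state D" "z \<in> state D" "y \<le> z"
  shows "emeasure (scale_measure D) {y..z} = ennreal (scale_function D z - scale_function D y)"
  unfolding scale_measure_def
proof (rule emeasure_density_Icc[OF continuous_on_scale_density[OF D] _ _ assms(2-4)])
  show "0 \<le> scale_density D x" for x by (simp add: scale_density_def)
  show "(scale_function D has_real_derivative scale_density D x) (at x)" if "x \<in> state D" for x
    using has_derivative_indefinite_integral[OF continuous_on_scale_density[OF D] _ that] D
    unfolding scale_function_def[abs_def] diffusion_condition_def by simp
qed

lemma emeasure_speed_measure_Icc:
  assumes D: "diffusion_condition D" and yz: "y \<in> state D" "z \<in> state D" "y \<le> z"
  shows "emeasure (speed_measure D) {y..z} = ennreal (LBINT v=y..z. speed_density D v)"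
proof -
  have c: "continuous_on (state D) (speed_density D)"
    unfolding speed_density_def[abs_def]
    using D continuous_on_scale_density[OF D] unfolding diffusion_condition_def
    by (intro continuous_intros) (auto simp: scale_density_def)
  have "emeasure (speed_measure D) {y..z}
      = ennreal ((LBINT v=ereal y..ereal z. speed_density D v)
               - (LBINT v=ereal y..ereal y. speed_density D v))"
    unfolding speed_measure_def
  proof (rule emeasure_density_Icc[OF c _ _ yz])
    show "0 \<le> speed_density D x" for x by (simp add: speed_density_def scale_density_def)
    show "((\<lambda>x. LBINT v=ereal y..ereal x. speed_density D v)
            has_real_derivative speed_density D x) (at x)" if "x \<in> state D" for x
      using has_derivative_indefinite_integral[OF c yz(1) that] .
  qed
  then show ?thesis by simp
qed

end

theory Submission
  imports Defs
begin

text \<open>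
  Both \<open>g\<^sub>0\<close> and \<open>\<zeta>\<close> are distribution functions of measures with continuous densities on the open
  state interval, and the ratio of these densities at \<open>u\<close> is the \<open>M\<close>-average of \<open>c\<^sub>0\<close> over \<open>[u, b)\<close>.
  It tends to infinity at \<open>b\<close> and at a natural \<open>a\<close>, because \<open>c\<^sub>0\<close> is inf-compact. A pair with
  \<open>F(y, z) \<le> K\<close> satisfies \<open>H(z) - H(y) \<ge> k\<^sub>1\<close> for \<open>H = K \<zeta> - g\<^sub>0\<close>; as \<open>H\<close> eventually decreases to
  \<open>-\<infinity>\<close> at \<open>b\<close>, and decreases from \<open>\<infinity>\<close> at a natural \<open>a\<close>, all such pairs lie in a compact set of
  pairs with \<open>B\<zeta> \<ge> k\<^sub>1 / K\<close>, on which \<open>F\<close> is continuous with extended real values. The first-order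
  conditions come from the function \<open>c\<^sub>1 + Bg\<^sub>0 - F\<^sub>* B\<zeta> \<ge> 0\<close>, which vanishes at a minimizer.
\<close>

section \<open>Measures with a continuous density on the state interval\<close>

text \<open>Two asymmetries shape the argument. At \<open>b\<close> the function \<zeta> may stay
  bounded (entrance case), while \<open>g0\<close> always diverges; at a natural \<open>a\<close> it
  is \<zeta> that is known to diverge. Domination of the densities at level \<open>K\<close> would
  only make \<open>H\<close> monotone near the ends, so it is established at level
  \<open>2 * K\<close>, and the surplus is spent on \<open>g0\<close> near \<open>b\<close> and on
  \<zeta> near a natural \<open>a\<close>. At a natural \<open>a\<close>, large values of
  \<open>c0\<close> close to \<open>a\<close> must outweigh a whole tail \<open>[u, b)\<close>; this
  works because \<open>S(a, x]\<close> is finite, so divergence of the classifying integral forces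
  \<open>M(a, x] = \<infinity>\<close>. At an attainable \<open>a\<close> no growth is exploited:
  \<open>a\<close> itself becomes the left end of the compact interval. There \<open>g0\<close> may
  be \<open>-\<infinity>\<close>, so continuity of \<open>F\<close> has to hold up to points where
  its value is \<open>\<infinity>\<close>. Iterated integrals against \<open>M\<close> and
  \<open>S\<close> are all rewritten as masses of measures with one continuous density, which is
  what makes calculus available.\<close>

definition state_density :: "diffusion \<Rightarrow> (real \<Rightarrow> real) \<Rightarrow> real measure" where
  "state_density D f = density lborel (\<lambda>x. ennreal (f x) * indicator (state D) x)"

lemma open_state: "open (state D)"
  unfolding state_def by simp

lemma state_in_borel [measurable]: "state D \<in> sets borel"
  using open_state by (rule borel_open)

lemma state_between: "x \<in> state D \<Longrightarrow> z \<in> state D \<Longrightarrow> x \<le> y \<Longrightarrow> y \<le> z \<Longrightarrow> y \<in> state D"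
  using Icc_subset_state[of x D z] by auto

lemma sets_state_density [simp, measurable_cong]: "sets (state_density D f) = sets borel"
  by (simp add: state_density_def)

lemma space_state_density [simp]: "space (state_density D f) = UNIV"
  by (simp add: state_density_def)

lemma state_density_cong:
  assumes "\<And>x. x \<in> state D \<Longrightarrow> f x = g x"
  shows "state_density D f = state_density D g"
proof -
  have "(\<lambda>x. ennreal (f x) * indicator (state D) x) = (\<lambda>x. ennreal (g x) * indicator (state D) x)"
    using assms by (auto simp: indicator_def)
  then show ?thesis by (simp add: state_density_def)
qed

lemma scale_measure_eq: "scale_measure D = state_density D (scale_density D)"
  by (simp add: scale_measure_def state_density_def)

lemma speed_measure_eq: "speed_measure D = state_density D (speed_density D)"
  by (simp add: speed_measure_def state_density_def)

lemma measurable_indicator_state: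
  assumes "continuous_on (state D) (f :: real \<Rightarrow> real)"
  shows "(\<lambda>x. ennreal (f x) * indicator (state D) x) \<in> borel_measurable borel"
proof -
  have "(\<lambda>x. indicator (state D) x *\<^sub>R f x) \<in> borel_measurable borel"
    using assms by (intro borel_measurable_continuous_on_indicator) auto
  then have "(\<lambda>x. ennreal (indicator (state D) x *\<^sub>R f x)) \<in> borel_measurable borel"
    by simp
  moreover have "(\<lambda>x. ennreal (indicator (state D) x *\<^sub>R f x)) = (\<lambda>x. ennreal (f x) * indicator (state D) x)"
    by (auto simp: indicator_def)
  ultimately show ?thesis by simp
qed

lemma AE_state_density_iff:
  assumes "continuous_on (state D) f"
  shows "(AE x in state_density D f. P x) \<longleftrightarrow>
    (AE x in lborel. 0 < ennreal (f x) * indicator (state D) x \<longrightarrow> P x)"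
  unfolding state_density_def using measurable_indicator_state[OF assms] by (intro AE_density) simp

lemma AE_in_state:
  assumes "continuous_on (state D) f"
  shows "AE x in state_density D f. x \<in> state D"
  unfolding AE_state_density_iff[OF assms] by (auto simp: indicator_def)

lemma emeasure_state_density:
  assumes "continuous_on (state D) f" "A \<in> sets borel"
  shows "emeasure (state_density D f) A
    = (\<integral>\<^sup>+x. ennreal (f x) * indicator (state D) x * indicator A x \<partial>lborel)"
  unfolding state_density_def using assms measurable_indicator_state[OF assms(1)]
  by (subst emeasure_density) auto

lemma emeasure_state_density_cong_set:
  assumes "continuous_on (state D) f" "A \<in> sets borel" "B \<in> sets borel"
    and "A \<inter> state D = B \<inter> state D"
  shows "emeasure (state_density D f) A = emeasure (state_density D f) B"
  unfolding emeasure_state_density[OF assms(1,2)] emeasure_state_density[OF assms(1,3)]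
  using assms(4) by (intro nn_integral_cong) (auto simp: indicator_def)

lemma emeasure_state_density_mono:
  assumes "continuous_on (state D) f" "continuous_on (state D) g" "A \<in> sets borel"
    and "\<And>x. x \<in> state D \<Longrightarrow> x \<in> A \<Longrightarrow> f x \<le> g x"
  shows "emeasure (state_density D f) A \<le> emeasure (state_density D g) A"
  unfolding emeasure_state_density[OF assms(1,3)] emeasure_state_density[OF assms(2,3)]
  using assms(4) by (intro nn_integral_mono) (auto simp: indicator_def intro: ennreal_leI)

lemma emeasure_state_density_cmult:
  assumes "continuous_on (state D) f" "A \<in> sets borel" "0 \<le> c"
  shows "emeasure (state_density D (\<lambda>x. c * f x)) A = ennreal c * emeasure (state_density D f) A"
proof -
  have "emeasure (state_density D (\<lambda>x. c * f x)) A
      = (\<integral>\<^sup>+x. ennreal c * (ennreal (f x) * indicator (state D) x * indicator A x) \<partial>lborel)"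
    unfolding emeasure_state_density[OF continuous_on_mult_left[OF assms(1)] assms(2)]
    by (intro nn_integral_cong) (auto simp: ennreal_mult' assms(3) mult_ac)
  also have "\<dots> = ennreal c * emeasure (state_density D f) A"
    unfolding emeasure_state_density[OF assms(1,2)]
    using measurable_indicator_state[OF assms(1)] assms(2) by (intro nn_integral_cmult) auto
  finally show ?thesis .
qed

text \<open>Reweighting: integrating a tail of one measure against another gives again the mass of a
  measure with a continuous density. \<open>W\<close> is prescribed only on the state interval,
  which carries all the mass.\<close>

lemma nn_integral_state_density:
  assumes f: "continuous_on (state D) f" "\<And>x. x \<in> state D \<Longrightarrow> 0 \<le> f x"
    and w: "continuous_on (state D) w" "\<And>x. x \<in> state D \<Longrightarrow> 0 \<le> w x"
      "\<And>x. x \<in> state D \<Longrightarrow> W x = ennreal (w x)"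
    and A: "A \<in> sets borel"
  shows "(\<integral>\<^sup>+x\<in>A. W x \<partial>state_density D f) = emeasure (state_density D (\<lambda>x. w x * f x)) A"
proof -
  have "(\<integral>\<^sup>+x\<in>A. W x \<partial>state_density D f)
      = (\<integral>\<^sup>+x. ennreal (w x) * indicator (state D) x * indicator A x \<partial>state_density D f)"
    using AE_in_state[OF f(1)] by (intro nn_integral_cong_AE) (auto simp: w(3) indicator_def)
  also have "\<dots> = (\<integral>\<^sup>+x. ennreal (f x) * indicator (state D) x
      * (ennreal (w x) * indicator (state D) x * indicator A x) \<partial>lborel)"
    unfolding state_density_def
    using measurable_indicator_state[OF f(1)] measurable_indicator_state[OF w(1)] A
    by (intro nn_integral_density) auto
  also have "\<dots> = emeasure (state_density D (\<lambda>x. w x * f x)) A"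
    unfolding emeasure_state_density[OF continuous_on_mult[OF w(1) f(1)] A]
    using f(2) w(2) by (intro nn_integral_cong) (auto simp: indicator_def ennreal_mult mult.commute)
  finally show ?thesis .
qed

lemma emeasure_state_density_Icc:
  assumes f: "continuous_on (state D) f" "\<And>x. x \<in> state D \<Longrightarrow> 0 \<le> f x"
    and r: "r \<in> state D" and yz: "y \<in> state D" "z \<in> state D" "y \<le> z"
  shows "emeasure (state_density D f) {y..z} = ennreal ((LBINT v=ereal r..ereal z. f v) - (LBINT v=ereal r..ereal y. f v))"
proof -
  \<comment> \<open>\<open>emeasure_density_Icc\<close> asks for a density that is nonnegative on
    the whole real line; truncation leaves the measure unchanged.\<close>
  have "state_density D f = state_density D (\<lambda>x. max 0 (f x))"
    using f(2) by (intro state_density_cong) simp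
  then show ?thesis
    unfolding state_density_def
    using emeasure_density_Icc[of D "\<lambda>x. max 0 (f x)" "\<lambda>x. LBINT v=ereal r..ereal x. f v" y z]
      has_derivative_indefinite_integral[OF f(1) r] f yz
    by (simp add: continuous_on_max)
qed

lemma indefinite_integral_mono:
  fixes f :: "real \<Rightarrow> real"
  assumes f: "continuous_on (state D) f" "\<And>x. x \<in> state D \<Longrightarrow> 0 \<le> f x"
    and r: "r \<in> state D" and yz: "y \<in> state D" "z \<in> state D" "y \<le> z"
  shows "(LBINT v=ereal r..ereal y. f v) \<le> (LBINT v=ereal r..ereal z. f v)"
proof (rule DERIV_nonneg_imp_nondecreasing[OF yz(3), of "\<lambda>x. LBINT v=ereal r..ereal x. f v"])
  fix x assume "y \<le> x" "x \<le> z"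
  then have "x \<in> state D" using yz state_between by blast
  then show "\<exists>d. ((\<lambda>z. LBINT v=ereal r..ereal z. f v) has_real_derivative d) (at x) \<and> 0 \<le> d"
    using has_derivative_indefinite_integral[OF f(1) r] f(2) by blast
qed

lemma emeasure_state_density_Icc_finite:
  assumes f: "continuous_on (state D) f" "\<And>x. x \<in> state D \<Longrightarrow> 0 \<le> f x"
    and yz: "y \<in> state D" "z \<in> state D"
  shows "emeasure (state_density D f) {y..z} < \<infinity>"
proof (cases "y \<le> z")
  case True
  then show ?thesis using emeasure_state_density_Icc[OF f yz(1) yz] by (simp add: less_top)
qed simp

lemma emeasure_state_density_singleton:
  assumes "continuous_on (state D) f"
  shows "emeasure (state_density D f) {x} = 0"
proof -
  have "emeasure (state_density D f) {x} = (\<integral>\<^sup>+v. 0 \<partial>(lborel :: real measure))"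
    unfolding emeasure_state_density[OF assms borel_singleton[OF sets.empty_sets]]
  proof (rule nn_integral_cong_AE)
    show "AE v in lborel. ennreal (f v) * indicator (state D) v * indicator {x} v = 0"
      using AE_lborel_singleton[of x] by eventually_elim (auto simp: indicator_def)
  qed
  then show ?thesis by simp
qed

lemma emeasure_state_density_insert:
  assumes "continuous_on (state D) f" "A \<in> sets borel"
  shows "emeasure (state_density D f) (insert x A) = emeasure (state_density D f) A"
proof -
  have "emeasure (state_density D f) (A \<union> {x}) = emeasure (state_density D f) A"
    using emeasure_state_density_singleton[OF assms(1)] assms(2)
    by (intro emeasure_Un_null_set) (auto simp: null_sets_def)
  then show ?thesis by simp
qed

lemma emeasure_state_density_atLeast_split:
  assumes "continuous_on (state D) f" "x \<le> y"
  shows "emeasure (state_density D f) {x..}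
    = emeasure (state_density D f) {x..y} + emeasure (state_density D f) {y..}"
proof -
  have "emeasure (state_density D f) {x..}
      = emeasure (state_density D f) {x..y} + emeasure (state_density D f) {y<..}"
    using assms(2) plus_emeasure[of "{x..y}" "state_density D f" "{y<..}"]
    by (simp add: ivl_disj_un ivl_disj_int)
  moreover have "insert y {y<..} = {y..}" by auto
  ultimately show ?thesis
    using emeasure_state_density_insert[OF assms(1), of "{y<..}" y] by simp
qed

lemma emeasure_state_density_atMost_split:
  assumes "continuous_on (state D) f" "x \<le> y"
  shows "emeasure (state_density D f) {..y}
    = emeasure (state_density D f) {..x} + emeasure (state_density D f) {x..y}"
proof -
  have "emeasure (state_density D f) {..y}
      = emeasure (state_density D f) {..x} + emeasure (state_density D f) {x<..y}"
    using assms(2) plus_emeasure[of "{..x}" "state_density D f" "{x<..y}"]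
    by (simp add: ivl_disj_un ivl_disj_int)
  moreover have "insert x {x<..y} = {x..y}" using assms(2) by auto
  ultimately show ?thesis
    using emeasure_state_density_insert[OF assms(1), of "{x<..y}" x] by simp
qed

section \<open>Compact exhaustion and continuity of tails\<close>

lemma state_exhaustion:
  assumes "lower D < upper D"
  obtains l u :: "nat \<Rightarrow> real" where "state D = (\<Union>i. {l i..u i})" "incseq u" "decseq l"
    "\<And>i. l i < u i" "\<And>i. l i \<in> state D" "\<And>i. u i \<in> state D"
proof (rule einterval_Icc_approximation[OF assms])
  fix u l :: "nat \<Rightarrow> real" assume *: "einterval (lower D) (upper D) = (\<Union>i. {l i..u i})"
    "incseq u" "decseq l" "\<And>i. l i < u i" "\<And>i. lower D < l i" "\<And>i. u i < upper D"
    "(\<lambda>x. ereal (l x)) \<longlonglongrightarrow> lower D" "(\<lambda>x. ereal (u x)) \<longlonglongrightarrow> upper D"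
  have eq: "state D = (\<Union>i. {l i..u i})" using *(1) by (simp add: state_def)
  have "l i \<in> {l i..u i}" "u i \<in> {l i..u i}" for i using *(4)[of i] by simp_all
  then have "l i \<in> state D" "u i \<in> state D" for i
    unfolding eq by (auto intro: UN_I[of i])
  then show ?thesis using that[OF eq *(2,3,4)] by blast
qed

lemma state_density_approx_lower:
  assumes ne: "lower D < upper D" and f: "continuous_on (state D) f"
    and x: "x \<in> state D" and c: "c < emeasure (state_density D f) {..x}"
  obtains l where "l \<in> state D" "l \<le> x" "c < emeasure (state_density D f) {l..x}"
proof (rule state_exhaustion[OF ne])
  fix l u :: "nat \<Rightarrow> real" assume eq: "state D = (\<Union>i. {l i..u i})" and "incseq u" "decseq l"
    and l: "\<And>i. l i < u i" "\<And>i. l i \<in> state D" "\<And>i. u i \<in> state D"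
  have "emeasure (state_density D f) {..x} = emeasure (state_density D f) (\<Union>i. {l i..x})"
  proof (rule emeasure_state_density_cong_set[OF f])
    have "\<exists>i. l i \<le> y" if "y \<in> state D" for y using that unfolding eq by auto
    then show "{..x} \<inter> state D = (\<Union>i. {l i..x}) \<inter> state D" by auto
  qed auto
  moreover have "(\<lambda>i. emeasure (state_density D f) {l i..x}) \<longlonglongrightarrow> emeasure (state_density D f) (\<Union>i. {l i..x})"
    using \<open>decseq l\<close> by (intro Lim_emeasure_incseq) (auto simp: incseq_def decseq_def intro: order_trans)
  ultimately have "\<forall>\<^sub>F i in sequentially. c < emeasure (state_density D f) {l i..x}"
    using c order_tendstoD(1) by metis
  then obtain i where i: "c < emeasure (state_density D f) {l i..x}"
    using eventually_sequentially by auto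
  \<comment> \<open>An empty interval has mass 0, which cannot exceed \<open>c\<close>.\<close>
  then have "l i \<le> x" by (cases "l i \<le> x") auto
  then show ?thesis using that i l by blast
qed

lemma state_density_approx_upper:
  assumes ne: "lower D < upper D" and f: "continuous_on (state D) f"
    and x: "x \<in> state D" and c: "c < emeasure (state_density D f) {x..}"
  obtains h where "h \<in> state D" "x \<le> h" "c < emeasure (state_density D f) {x..h}"
proof (rule state_exhaustion[OF ne])
  fix l u :: "nat \<Rightarrow> real" assume eq: "state D = (\<Union>i. {l i..u i})" and "incseq u" "decseq l"
    and l: "\<And>i. l i < u i" "\<And>i. l i \<in> state D" "\<And>i. u i \<in> state D"
  have "emeasure (state_density D f) {x..} = emeasure (state_density D f) (\<Union>i. {x..u i})"
  proof (rule emeasure_state_density_cong_set[OF f])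
    have "\<exists>i. y \<le> u i" if "y \<in> state D" for y using that unfolding eq by auto
    then show "{x..} \<inter> state D = (\<Union>i. {x..u i}) \<inter> state D" by auto
  qed auto
  moreover have "(\<lambda>i. emeasure (state_density D f) {x..u i}) \<longlonglongrightarrow> emeasure (state_density D f) (\<Union>i. {x..u i})"
    using \<open>incseq u\<close> by (intro Lim_emeasure_incseq) (auto simp: incseq_def intro: order_trans)
  ultimately have "\<forall>\<^sub>F i in sequentially. c < emeasure (state_density D f) {x..u i}"
    using c order_tendstoD(1) by metis
  then obtain i where i: "c < emeasure (state_density D f) {x..u i}"
    using eventually_sequentially by auto
  then have "x \<le> u i" by (cases "x \<le> u i") auto
  then show ?thesis using that i l by blast
qed

text \<open>A tail reaching to \<open>b\<close> is not an integral between interior points. With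
  \<open>w\<close> fixed to the right of \<open>x\<close>, the tail at \<open>y < w\<close> is a
  constant minus an indefinite integral, and the latter is differentiable.\<close>

lemma continuous_on_upper_tail:
  assumes f: "continuous_on (state D) f" "\<And>x. x \<in> state D \<Longrightarrow> 0 \<le> f x"
    and fin: "\<And>x. x \<in> state D \<Longrightarrow> emeasure (state_density D f) {x..} < \<infinity>"
  shows "continuous_on (state D) (\<lambda>x. measure (state_density D f) {x..})"
proof (rule continuous_at_imp_continuous_on, rule ballI)
  fix x assume x: "x \<in> state D"
  obtain e where e: "e > 0" "cball x e \<subseteq> state D"
    using open_state x open_contains_cball by blast
  define w where "w = x + e"
  have w: "w \<in> state D" using e by (auto simp: w_def subset_iff dist_real_def)
  let ?P = "\<lambda>y. LBINT v=ereal w..ereal y. f v"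
  have eq: "measure (state_density D f) {y..} = measure (state_density D f) {w..} - ?P y"
    if y: "y \<in> state D" "y < w" for y
  proof -
    have "emeasure (state_density D f) {y..}
      = ennreal (?P w - ?P y) + emeasure (state_density D f) {w..}"
      using y w by (subst emeasure_state_density_atLeast_split[OF f(1), of y w])
        (simp_all add: emeasure_state_density_Icc[OF f w])
    also have "\<dots> = ennreal ((?P w - ?P y) + measure (state_density D f) {w..})"
      using fin[OF w] indefinite_integral_mono[OF f w y(1) w] y(2)
      by (subst ennreal_plus) (simp_all add: emeasure_eq_ennreal_measure less_top)
    finally have "emeasure (state_density D f) {y..}
      = ennreal ((?P w - ?P y) + measure (state_density D f) {w..})" .
    moreover have "0 \<le> (?P w - ?P y) + measure (state_density D f) {w..}"
      using indefinite_integral_mono[OF f w y(1) w] y(2) measure_nonneg by (intro add_nonneg_nonneg) auto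
    ultimately show ?thesis
      by (simp add: measure_eq_emeasure_eq_ennreal)
  qed
  have "isCont ?P x" using has_derivative_indefinite_integral[OF f(1) w x] DERIV_isCont by blast
  then have "isCont (\<lambda>y. measure (state_density D f) {w..} - ?P y) x" by (intro continuous_intros)
  moreover have "\<forall>\<^sub>F y in nhds x. measure (state_density D f) {y..} = measure (state_density D f) {w..} - ?P y"
  proof -
    have "\<forall>\<^sub>F y in nhds x. y \<in> state D" using x open_state by (simp add: eventually_nhds_in_open)
    moreover have "\<forall>\<^sub>F y in nhds x. y < w"
      using e(1) eventually_nhds_in_open[of "{..<w}" x] by (simp add: w_def)
    ultimately show ?thesis by eventually_elim (rule eq)
  qed
  ultimately show "isCont (\<lambda>y. measure (state_density D f) {y..}) x"
    by (subst isCont_cong)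
qed

lemma emeasure_state_density_add:
  assumes f: "continuous_on (state D) f" "\<And>x. x \<in> state D \<Longrightarrow> 0 \<le> f x"
    and g: "continuous_on (state D) g" "\<And>x. x \<in> state D \<Longrightarrow> 0 \<le> g x"
    and A: "A \<in> sets borel"
  shows "emeasure (state_density D (\<lambda>x. f x + g x)) A
    = emeasure (state_density D f) A + emeasure (state_density D g) A"
proof -
  have "emeasure (state_density D (\<lambda>x. f x + g x)) A
      = (\<integral>\<^sup>+x. ennreal (f x) * indicator (state D) x * indicator A x
          + ennreal (g x) * indicator (state D) x * indicator A x \<partial>lborel)"
    unfolding emeasure_state_density[OF continuous_on_add[OF f(1) g(1)] A]
    using f(2) g(2) by (intro nn_integral_cong) (auto simp: indicator_def)
  also have "\<dots> = emeasure (state_density D f) A + emeasure (state_density D g) A"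
    unfolding emeasure_state_density[OF f(1) A] emeasure_state_density[OF g(1) A]
    using measurable_indicator_state[OF f(1)] measurable_indicator_state[OF g(1)] A
    by (intro nn_integral_add) auto
  finally show ?thesis .
qed

lemma state_less:
  assumes "x \<in> state D" obtains y where "y \<in> state D" "y < x"
proof -
  obtain e where e: "e > 0" "cball x e \<subseteq> state D"
    using open_state assms open_contains_cball by blast
  then have "x - e \<in> state D" by (auto simp: subset_iff dist_real_def)
  then show ?thesis using that e(1) by simp
qed

lemma state_greater:
  assumes "x \<in> state D" obtains y where "y \<in> state D" "x < y"
proof -
  obtain e where e: "e > 0" "cball x e \<subseteq> state D"
    using open_state assms open_contains_cball by blast
  then have "x + e \<in> state D" by (auto simp: subset_iff dist_real_def)
  then show ?thesis using that e(1) by simp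
qed

text \<open>The distribution function that vanishes at \<open>C\<close>. Its values are extended
  reals because the mass up to an adjoined boundary may be infinite; closed intervals on both sides
  are harmless since there are no atoms.\<close>

definition signed_dist :: "diffusion \<Rightarrow> real \<Rightarrow> (real \<Rightarrow> real) \<Rightarrow> real \<Rightarrow> ereal" where
  "signed_dist D C f x =
     (if C \<le> x then enn2ereal (emeasure (state_density D f) {C..x})
      else - enn2ereal (emeasure (state_density D f) {x..C}))"

lemma signed_dist_mono:
  assumes "x \<le> y" shows "signed_dist D C f x \<le> signed_dist D C f y"
proof -
  have "emeasure (state_density D f) {C..x} \<le> emeasure (state_density D f) {C..y}"
    "emeasure (state_density D f) {y..C} \<le> emeasure (state_density D f) {x..C}"
    using assms by (auto intro!: emeasure_mono)
  moreover have "- enn2ereal (emeasure (state_density D f) {x..C})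
      \<le> enn2ereal (emeasure (state_density D f) {C..y})"
    by (rule order_trans[of _ 0]) simp_all
  ultimately show ?thesis
    using assms by (auto simp: signed_dist_def less_eq_ennreal.rep_eq intro: order_trans)
qed

lemma signed_dist_cmult:
  assumes "continuous_on (state D) f" "0 \<le> c"
  shows "signed_dist D C (\<lambda>x. c * f x) x = ereal c * signed_dist D C f x"
  unfolding signed_dist_def
  using emeasure_state_density_cmult[OF assms(1) _ assms(2)] assms(2)
  by (simp add: times_ennreal.rep_eq enn2ereal_ennreal)

lemma oriented_integral_eq_signed_dist:
  assumes D: "diffusion_condition D"
    and T: "continuous_on (state D) T" "\<And>u. u \<in> state D \<Longrightarrow> 0 \<le> T u"
      "\<And>u. u \<in> state D \<Longrightarrow> W u = ennreal (T u)"
  shows "oriented_integral D C x W = signed_dist D C (\<lambda>u. T u * scale_density D u) x"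
  unfolding oriented_integral_def signed_dist_def scale_measure_eq
  using nn_integral_state_density[OF continuous_on_scale_density[OF D] _ T, where A="{C..x}"]
    nn_integral_state_density[OF continuous_on_scale_density[OF D] _ T, where A="{x..C}"]
  by (simp add: scale_density_def)

lemma signed_dist_interior:
  assumes f: "continuous_on (state D) f" "\<And>x. x \<in> state D \<Longrightarrow> 0 \<le> f x"
    and C: "C \<in> state D" and x: "x \<in> state D"
  shows "signed_dist D C f x = ereal (LBINT v=ereal C..ereal x. f v)"
proof -
  let ?P = "\<lambda>x. LBINT v=ereal C..ereal x. f v"
  have [simp]: "?P C = 0" by simp
  show ?thesis
  proof (cases "C \<le> x")
    case True
    then show ?thesis
      using emeasure_state_density_Icc[OF f C C x True] indefinite_integral_mono[OF f C C x True]
      by (simp add: signed_dist_def enn2ereal_ennreal)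
  next
    case False
    then have "x \<le> C" by simp
    then show ?thesis
      using emeasure_state_density_Icc[OF f C x C] indefinite_integral_mono[OF f C x C] False
      by (simp add: signed_dist_def enn2ereal_ennreal)
  qed
qed

lemma signed_dist_has_derivative:
  assumes f: "continuous_on (state D) f" "\<And>x. x \<in> state D \<Longrightarrow> 0 \<le> f x"
    and C: "C \<in> state D" and x: "x \<in> state D"
  shows "((\<lambda>x. real_of_ereal (signed_dist D C f x)) has_real_derivative f x) (at x)"
proof (rule has_field_derivative_transform_within_open[OF has_derivative_indefinite_integral[OF f(1) C x] open_state x])
  show "(LBINT v=ereal C..ereal y. f v) = real_of_ereal (signed_dist D C f y)" if "y \<in> state D" for y
    using signed_dist_interior[OF f C that] by simp
qed

lemma signed_dist_lower:
  assumes f: "continuous_on (state D) f" and C: "C \<in> state D" and l: "ereal l = lower D"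
  shows "signed_dist D C f l = - enn2ereal (emeasure (state_density D f) {..C})"
proof -
  have *: "l < x" if "x \<in> state D" for x
    using that by (simp add: state_def einterval_iff flip: l)
  then have "{..C} \<inter> state D = {l..C} \<inter> state D" by fastforce
  then have "emeasure (state_density D f) {..C} = emeasure (state_density D f) {l..C}"
    by (intro emeasure_state_density_cong_set[OF f]) auto
  then show ?thesis using *[OF C] by (simp add: signed_dist_def)
qed

lemma signed_dist_upper:
  assumes f: "continuous_on (state D) f" and C: "C \<in> state D" and h: "ereal h = upper D"
  shows "signed_dist D C f h = enn2ereal (emeasure (state_density D f) {C..})"
proof -
  have *: "x < h" if "x \<in> state D" for x
    using that by (simp add: state_def einterval_iff flip: h)
  then have "{C..} \<inter> state D = {C..h} \<inter> state D" by fastforce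
  then have "emeasure (state_density D f) {C..} = emeasure (state_density D f) {C..h}"
    by (intro emeasure_state_density_cong_set[OF f]) auto
  then show ?thesis using *[OF C] by (simp add: signed_dist_def)
qed

text \<open>Continuity of the measure from below, along intervals growing to \<open>{l<..C}\<close>,
  which differs from \<open>{l..C}\<close> by a null point. The limit may be
  \<open>-\<infinity>\<close>, so convergence is in the extended reals.\<close>

lemma signed_dist_at_right_lower:
  assumes f: "continuous_on (state D) f" and C: "C \<in> state D" and l: "ereal l = lower D"
  shows "(signed_dist D C f \<longlongrightarrow> signed_dist D C f l) (at_right l)"
proof (rule tendsto_at_right_sequentially)
  show "l < C" using C by (simp add: state_def einterval_iff flip: l)
  fix S assume S: "\<And>n. l < S n" "\<And>n. S n < C" "decseq S" "S \<longlonglongrightarrow> l"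
  have "\<exists>n. S n \<le> y" if "l < y" for y
    using order_tendstoD(2)[OF S(4) that] by (auto simp: eventually_sequentially intro: less_imp_le)
  moreover have "l < S n" for n by (rule S)
  ultimately have "(\<Union>n. {S n..C}) = {l<..C}"
    by (fastforce intro: less_le_trans)
  moreover have "insert l {l<..C} = {l..C}" using \<open>l < C\<close> by auto
  ultimately have eq: "emeasure (state_density D f) (\<Union>n. {S n..C}) = emeasure (state_density D f) {l..C}"
    using emeasure_state_density_insert[OF f, of "{l<..C}" l] by simp
  have "(\<lambda>n. emeasure (state_density D f) {S n..C}) \<longlonglongrightarrow> emeasure (state_density D f) (\<Union>n. {S n..C})"
    using S(3) by (intro Lim_emeasure_incseq) (auto simp: incseq_def decseq_def intro: order_trans)
  then have "(\<lambda>n. - enn2ereal (emeasure (state_density D f) {S n..C}))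
      \<longlonglongrightarrow> - enn2ereal (emeasure (state_density D f) {l..C})"
    unfolding eq by (intro tendsto_uminus_ereal tendsto_enn2erealI)
  moreover have "\<not> C \<le> S n" for n using S(2)[of n] by simp
  ultimately show "(\<lambda>n. signed_dist D C f (S n)) \<longlonglongrightarrow> signed_dist D C f l"
    using \<open>l < C\<close> by (simp add: signed_dist_def)
qed

text \<open>Compact subintervals have finite mass, so infinite mass near \<open>a\<close> does not
  depend on the right endpoint.\<close>

lemma state_density_atMost_top:
  assumes f: "continuous_on (state D) f" "\<And>x. x \<in> state D \<Longrightarrow> 0 \<le> f x"
    and xy: "x \<in> state D" "y \<in> state D"
    and top: "emeasure (state_density D f) {..x} = \<infinity>"
  shows "emeasure (state_density D f) {..y} = \<infinity>"
proof (cases "x \<le> y")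
  case True
  then have "emeasure (state_density D f) {..x} \<le> emeasure (state_density D f) {..y}"
    by (intro emeasure_mono) auto
  then show ?thesis using top by (simp add: top_unique)
next
  case False
  then show ?thesis
    using emeasure_state_density_atMost_split[OF f(1), of y x] top
      emeasure_state_density_Icc_finite[OF f xy(2,1)]
    by (metis ennreal_add_eq_top infinity_ennreal_def less_irrefl nle_le)
qed

text \<open>If \<open>d = \<infinity>\<close>, then \<open>b\<close> is finite or
  \<open>-\<infinity>\<close>, and the quotient is 0 in either case because division by
  \<open>\<infinity>\<close> is multiplication by 0; \<open>0 \<le> f\<close> settles it. A finite
  \<open>d\<close> is ordinary division.\<close>

lemma ereal_divide_le_of_le_mult:
  fixes a b d :: ereal and f :: real
  assumes "a + b \<le> ereal f * d" "\<bar>a\<bar> \<noteq> \<infinity>" "0 < d" "0 \<le> f" "\<not> (b = \<infinity> \<and> d = \<infinity>)"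
  shows "(a + b) / d \<le> ereal f"
proof (cases "d = \<infinity>")
  case True
  then have "b \<noteq> \<infinity>" using assms(5) by simp
  then show ?thesis using True assms(2,4) by (cases a; cases b) (auto simp: divide_ereal_def)
next
  case False
  then obtain r where r: "d = ereal r" "0 < r" using assms(3) by (cases d) auto
  then show ?thesis using assms(1) by (simp add: ereal_divide_le_pos mult.commute)
qed

section \<open>Derivatives and boundary behaviour of the cost functions\<close>

lemma continuous_on_speed_density:
  assumes "diffusion_condition D"
  shows "continuous_on (state D) (speed_density D)"
  unfolding speed_density_def[abs_def]
  using assms continuous_on_scale_density[OF assms] unfolding diffusion_condition_def
  by (intro continuous_intros) (auto simp: scale_density_def)

lemma scale_density_pos: "0 < scale_density D x"
  by (simp add: scale_density_def)

lemma speed_density_pos: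
  assumes "diffusion_condition D" "x \<in> state D"
  shows "0 < speed_density D x"
  using assms unfolding diffusion_condition_def by (simp add: speed_density_def scale_density_def)

section \<open>The densities of \<open>zeta\<close> and \<open>g0\<close> and their tails\<close>

locale inventory_problem =
  fixes D :: diffusion and c0 :: "real \<Rightarrow> real" and c1 :: "real \<times> real \<Rightarrow> real" and C :: real
  assumes D: "diffusion_condition D"
    and c0: "holding_cost_condition D c0"
    and c1: "ordering_cost_condition D c1"
    and C: "C \<in> state D"
begin

abbreviation "S \<equiv> state D"
abbreviation "s \<equiv> scale_density D"
abbreviation "m \<equiv> speed_density D"

definition "M_tail u = measure (state_density D m) {u..}"
definition "G_tail u = measure (state_density D (\<lambda>v. 2 * c0 v * m v)) {u..}"
definition "zeta' u = 2 * M_tail u * s u"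
definition "g0' u = G_tail u * s u"
text \<open>\<open>real_of_ereal\<close> sends infinite values to 0. \<open>Z\<close> represents
  \<open>zeta\<close> on all of \<open>estate D\<close>, but \<open>g\<close> represents
  \<open>g0\<close> only where \<open>g0\<close> is finite; hence the side conditions on
  \<open>g0\<close> wherever \<open>g\<close> is evaluated at a possible boundary point.\<close>

definition "Z x = real_of_ereal (zeta D C x)"
definition "g x = real_of_ereal (g0 D c0 C x)"

lemma lower_less_upper: "lower D < upper D"
  using D by (simp add: diffusion_condition_def)

lemma c0_nonneg: "x \<in> S \<Longrightarrow> 0 \<le> c0 x"
  using c0 by (simp add: holding_cost_condition_def)

lemma continuous_c0: "continuous_on S c0"
  using c0 by (simp add: holding_cost_condition_def)

lemma m_pos: "x \<in> S \<Longrightarrow> 0 < m x"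
  using D by (rule speed_density_pos)

lemmas continuous_m = continuous_on_speed_density[OF D]
lemmas continuous_s = continuous_on_scale_density[OF D]

lemma continuous_cost_density: "continuous_on S (\<lambda>v. 2 * c0 v * m v)"
  by (intro continuous_intros continuous_c0 continuous_m)

text \<open>A compact sublevel set lies in some \<open>[l1, h1]\<close> inside the open interval,
  which leaves room for \<open>l\<close> and \<open>h\<close> strictly outside it.\<close>

lemma c0_large:
  obtains l h where "l \<in> S" "h \<in> S" "l < h" "\<And>x. x \<in> S \<Longrightarrow> x \<le> l \<or> h \<le> x \<Longrightarrow> K < c0 x"
proof -
  \<comment> \<open>Inf-compactness speaks of positive levels only, hence
    \<open>max K 1\<close>.\<close>
  let ?A = "{x\<in>S. c0 x \<le> max K 1}"
  have "compact ?A" using c0 by (simp add: holding_cost_condition_def)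
  obtain l1 h1 where lh: "l1 \<in> S" "h1 \<in> S" "l1 \<le> h1" "\<And>x. x \<in> ?A \<Longrightarrow> l1 \<le> x \<and> x \<le> h1"
  proof (cases "?A = {}")
    case True
    then show ?thesis using that[OF C C] by auto
  next
    case False
    obtain l1 where "l1 \<in> ?A" "\<And>x. x \<in> ?A \<Longrightarrow> l1 \<le> x"
      using compact_attains_inf[OF \<open>compact ?A\<close> False] by auto
    moreover obtain h1 where "h1 \<in> ?A" "\<And>x. x \<in> ?A \<Longrightarrow> x \<le> h1"
      using compact_attains_sup[OF \<open>compact ?A\<close> False] by auto
    ultimately show ?thesis using that[of l1 h1] by auto
  qed
  obtain l where l: "l \<in> S" "l < l1" using lh(1) by (rule state_less)
  obtain h where h: "h \<in> S" "h1 < h" using lh(2) by (rule state_greater)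
  have "K < c0 x" if "x \<in> S" "x \<le> l \<or> h \<le> x" for x
    using that lh(4)[of x] l h by fastforce
  moreover have "l < h" using l h lh(3) by linarith
  ultimately show ?thesis using that l h by blast
qed

lemma cost_tail_eq:
  "(\<integral>\<^sup>+v\<in>{y..}. ennreal (c0 v) \<partial>speed_measure D) = emeasure (state_density D (\<lambda>v. c0 v * m v)) {y..}"
  "(\<integral>\<^sup>+v\<in>{y..}. ennreal (2 * c0 v) \<partial>speed_measure D) = emeasure (state_density D (\<lambda>v. 2 * c0 v * m v)) {y..}"
proof -
  have "continuous_on S (\<lambda>v. 2 * c0 v)" by (intro continuous_intros continuous_c0)
  then show
    "(\<integral>\<^sup>+v\<in>{y..}. ennreal (c0 v) \<partial>speed_measure D) = emeasure (state_density D (\<lambda>v. c0 v * m v)) {y..}"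
    "(\<integral>\<^sup>+v\<in>{y..}. ennreal (2 * c0 v) \<partial>speed_measure D) = emeasure (state_density D (\<lambda>v. 2 * c0 v * m v)) {y..}"
    unfolding speed_measure_eq
    using c0_nonneg m_pos continuous_m continuous_c0
    by (auto intro!: nn_integral_state_density intro: less_imp_le)
qed

lemma emeasure_double_cost:
  "emeasure (state_density D (\<lambda>v. 2 * c0 v * m v)) {y..} = 2 * emeasure (state_density D (\<lambda>v. c0 v * m v)) {y..}"
  using emeasure_state_density_cmult[of D "\<lambda>v. c0 v * m v" "{y..}" 2]
  by (simp add: continuous_c0 continuous_m continuous_on_mult mult.assoc)

lemma G_tail_finite:
  assumes "y \<in> S" shows "emeasure (state_density D (\<lambda>v. 2 * c0 v * m v)) {y..} < \<infinity>"
proof -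
  have "(\<integral>\<^sup>+v\<in>{y..}. ennreal (c0 v) \<partial>speed_measure D) < \<infinity>"
    using c0 assms by (simp add: holding_cost_condition_def)
  then show ?thesis
    unfolding emeasure_double_cost cost_tail_eq by (simp add: ennreal_mult_less_top)
qed

lemma emeasure_cost_ge:
  assumes "A \<in> sets borel" "0 \<le> K" "\<And>x. x \<in> S \<Longrightarrow> x \<in> A \<Longrightarrow> K \<le> c0 x"
  shows "ennreal (2 * K) * emeasure (state_density D m) A
    \<le> emeasure (state_density D (\<lambda>v. 2 * c0 v * m v)) A"
proof -
  have "ennreal (2 * K) * emeasure (state_density D m) A = emeasure (state_density D (\<lambda>x. 2 * K * m x)) A"
    using emeasure_state_density_cmult[OF continuous_m assms(1), of "2 * K"] assms(2) by simp
  also have "\<dots> \<le> emeasure (state_density D (\<lambda>v. 2 * c0 v * m v)) A"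
    using assms m_pos
    by (intro emeasure_state_density_mono continuous_cost_density continuous_on_mult_left continuous_m)
      (auto intro!: mult_right_mono less_imp_le)
  finally show ?thesis .
qed

text \<open>Near \<open>b\<close> one has \<open>c0 > 1\<close>, so there the speed measure is
  dominated by the integrable cost; what remains is a compact interval.\<close>

lemma M_tail_finite:
  assumes "y \<in> S" shows "emeasure (state_density D m) {y..} < \<infinity>"
proof -
  obtain l h where lh: "l \<in> S" "h \<in> S" "l < h" "\<And>x. x \<in> S \<Longrightarrow> x \<le> l \<or> h \<le> x \<Longrightarrow> 1 < c0 x"
    using c0_large by metis
  define w where "w = max y h"
  have w: "w \<in> S" using assms lh by (simp add: w_def max_def)
  have "ennreal (2 * 1) * emeasure (state_density D m) {w..}
      \<le> emeasure (state_density D (\<lambda>v. 2 * c0 v * m v)) {w..}"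
    using lh(4) by (intro emeasure_cost_ge) (auto simp: w_def intro: less_imp_le)
  then have "ennreal (2 * 1) * emeasure (state_density D m) {w..} < \<infinity>"
    using G_tail_finite[OF w] by (rule le_less_trans)
  then have "emeasure (state_density D m) {w..} < \<infinity>"
    by (auto simp: ennreal_mult_less_top)
  moreover have "emeasure (state_density D m) {y..w} < \<infinity>"
    using emeasure_state_density_Icc_finite[OF continuous_m _ assms w] m_pos by (simp add: less_imp_le)
  ultimately show ?thesis
    using emeasure_state_density_atLeast_split[OF continuous_m, of y w] by (simp add: w_def)
qed

lemma emeasure_M_tail: "y \<in> S \<Longrightarrow> emeasure (state_density D m) {y..} = ennreal (M_tail y)"
  using M_tail_finite[of y] unfolding M_tail_def by (simp add: emeasure_eq_ennreal_measure less_top)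

lemma emeasure_G_tail:
  "y \<in> S \<Longrightarrow> emeasure (state_density D (\<lambda>v. 2 * c0 v * m v)) {y..} = ennreal (G_tail y)"
  using G_tail_finite[of y] unfolding G_tail_def by (simp add: emeasure_eq_ennreal_measure less_top)

lemma continuous_M_tail: "continuous_on S M_tail"
  unfolding M_tail_def[abs_def]
  using M_tail_finite m_pos by (intro continuous_on_upper_tail continuous_m) (auto intro: less_imp_le)

lemma continuous_G_tail: "continuous_on S G_tail"
  unfolding G_tail_def[abs_def]
  using G_tail_finite m_pos c0_nonneg
  by (intro continuous_on_upper_tail continuous_cost_density)
      (auto intro!: mult_nonneg_nonneg intro: less_imp_le)

lemma M_tail_nonneg: "0 \<le> M_tail u" and G_tail_nonneg: "0 \<le> G_tail u"
  by (simp_all add: M_tail_def G_tail_def)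

lemma M_tail_antimono: "u \<in> S \<Longrightarrow> u \<le> v \<Longrightarrow> M_tail v \<le> M_tail u"
  unfolding M_tail_def using M_tail_finite[of u]
  by (intro measure_mono_fmeasurable) (auto simp: fmeasurable_def)

lemma emeasure_M_Icc:
  assumes "u \<in> S" "v \<in> S" "u \<le> v"
  shows "emeasure (state_density D m) {u..v} = ennreal (M_tail u - M_tail v)"
proof -
  have "ennreal (M_tail u) = emeasure (state_density D m) {u..v} + ennreal (M_tail v)"
    using emeasure_state_density_atLeast_split[OF continuous_m assms(3)] assms
    by (simp add: emeasure_M_tail)
  then show ?thesis
    using M_tail_nonneg[of v] by (simp add: ennreal_minus[symmetric])
qed

lemma M_tail_pos:
  assumes u: "u \<in> S" shows "0 < M_tail u"
proof -
  obtain w where w: "w \<in> S" "u < w" using u by (rule state_greater)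
  let ?P = "\<lambda>x. LBINT v=ereal u..ereal x. m v"
  have "?P u < ?P w"
  proof (rule DERIV_pos_imp_increasing[OF w(2)])
    fix x assume "u \<le> x" "x \<le> w"
    then have "x \<in> S" using u w state_between by blast
    then show "\<exists>y. (?P has_real_derivative y) (at x) \<and> 0 < y"
      using has_derivative_indefinite_integral[OF continuous_m u] m_pos by blast
  qed
  moreover have "ennreal (M_tail u - M_tail w) = ennreal (?P w - ?P u)"
    using emeasure_M_Icc[OF u w(1)] emeasure_state_density_Icc[OF continuous_m _ u u w(1)] w(2) m_pos
    by (simp add: less_imp_le)
  ultimately have "0 < ennreal (M_tail u - M_tail w)" by (simp del: interval_integral_endpoints_same)
  then show ?thesis using M_tail_nonneg[of w] by (simp add: ennreal_less_zero_iff)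
qed

lemma zeta'_pos: "u \<in> S \<Longrightarrow> 0 < zeta' u"
  by (simp add: zeta'_def M_tail_pos scale_density_pos)

lemma zeta'_nonneg: "u \<in> S \<Longrightarrow> 0 \<le> zeta' u"
  using zeta'_pos by (simp add: less_imp_le)

lemma g0'_nonneg: "0 \<le> g0' u"
  by (simp add: g0'_def G_tail_nonneg scale_density_pos less_imp_le)

lemma continuous_zeta': "continuous_on S zeta'" and continuous_g0': "continuous_on S g0'"
  unfolding zeta'_def[abs_def] g0'_def[abs_def]
  by (intro continuous_intros continuous_M_tail continuous_G_tail continuous_s)+

lemma g0_eq: "g0 D c0 C x = signed_dist D C g0' x"
  unfolding g0_def g0'_def[abs_def]
  using G_tail_nonneg continuous_G_tail
  by (intro oriented_integral_eq_signed_dist[OF D]) (simp_all add: cost_tail_eq emeasure_G_tail)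

lemma zeta_eq: "zeta D C x = signed_dist D C zeta' x"
proof -
  have "oriented_integral D C x (\<lambda>u. emeasure (speed_measure D) {u..})
      = signed_dist D C (\<lambda>u. M_tail u * s u) x"
    using M_tail_nonneg continuous_M_tail
    by (intro oriented_integral_eq_signed_dist[OF D]) (simp_all add: speed_measure_eq emeasure_M_tail)
  moreover have "signed_dist D C (\<lambda>u. 2 * (M_tail u * s u)) x = 2 * signed_dist D C (\<lambda>u. M_tail u * s u) x"
    by (subst signed_dist_cmult) (auto intro!: continuous_intros continuous_M_tail continuous_s)
  ultimately show ?thesis by (simp add: zeta_def zeta'_def[abs_def] mult.assoc)
qed

lemma g0_real: "x \<in> S \<Longrightarrow> g0 D c0 C x = ereal (g x)"
  unfolding g_def g0_eq by (simp add: signed_dist_interior[OF continuous_g0' g0'_nonneg C])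

lemma zeta_real: "x \<in> S \<Longrightarrow> zeta D C x = ereal (Z x)"
  unfolding Z_def zeta_eq by (simp add: signed_dist_interior[OF continuous_zeta' zeta'_nonneg C])

lemma g_deriv: "x \<in> S \<Longrightarrow> (g has_real_derivative g0' x) (at x)"
  unfolding g_def[abs_def] g0_eq by (rule signed_dist_has_derivative[OF continuous_g0' g0'_nonneg C])

lemma Z_deriv: "x \<in> S \<Longrightarrow> (Z has_real_derivative zeta' x) (at x)"
  unfolding Z_def[abs_def] zeta_eq by (rule signed_dist_has_derivative[OF continuous_zeta' zeta'_nonneg C])

lemma ederiv_g0: "x \<in> S \<Longrightarrow> ederiv (g0 D c0 C) x = g0' x"
  using g_deriv[of x] unfolding ederiv_def g_def[abs_def] by (rule DERIV_imp_deriv)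

lemma ederiv_zeta: "x \<in> S \<Longrightarrow> ederiv (zeta D C) x = zeta' x"
  using Z_deriv[of x] unfolding ederiv_def Z_def[abs_def] by (rule DERIV_imp_deriv)

lemma g0_mono: "x \<le> y \<Longrightarrow> g0 D c0 C x \<le> g0 D c0 C y"
  unfolding g0_eq by (rule signed_dist_mono)

lemma zeta_mono: "x \<le> y \<Longrightarrow> zeta D C x \<le> zeta D C y"
  unfolding zeta_eq by (rule signed_dist_mono)

section \<open>Boundary classification as finite or infinite mass\<close>

lemma M_below_state_density:
  assumes x: "x \<in> S"
  shows "(\<integral>\<^sup>+u\<in>{..x}. emeasure (speed_measure D) {u..x} \<partial>scale_measure D)
    = emeasure (state_density D (\<lambda>u. max 0 (M_tail u - M_tail x) * s u)) {..x}"
  unfolding scale_measure_eq speed_measure_eq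
proof (rule nn_integral_state_density)
  \<comment> \<open>For \<open>u > x\<close> the interval is empty and the difference of tails is
    not positive; the truncation at 0 gives the right value there and keeps the density continuous
    on the whole state interval.\<close>
  show "emeasure (state_density D m) {u..x} = ennreal (max 0 (M_tail u - M_tail x))" if "u \<in> S" for u
  proof (cases "u \<le> x")
    case True
    then show ?thesis using emeasure_M_Icc[OF that x True] M_tail_antimono[OF that True] by simp
  next
    case False
    then show ?thesis using M_tail_antimono[OF x, of u] by simp
  qed
qed (auto intro!: continuous_intros continuous_s continuous_M_tail simp: scale_density_pos less_imp_le)

lemma scale_below_finite: "x \<in> S \<Longrightarrow> emeasure (state_density D s) {..x} < \<infinity>"
  using D unfolding diffusion_condition_def lower_attracting_def scale_measure_eq by auto

text \<open>For \<open>u \<le> C\<close> the tail \<open>M[u, b)\<close> splits into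
  \<open>M[u, C]\<close>, integrable against \<open>S\<close> because \<open>a\<close> is
  attainable, and the constant \<open>M[C, b)\<close>, integrable because \<open>a\<close> is
  attracting.\<close>

lemma zeta'_below_finite:
  assumes "lower_attainable D"
  shows "emeasure (state_density D zeta') {..C} < \<infinity>"
proof -
  let ?a = "\<lambda>u. max 0 (M_tail u - M_tail C) * s u"
  have a: "continuous_on S ?a" "continuous_on S (\<lambda>u. M_tail C * s u)"
    by (intro continuous_intros continuous_s continuous_M_tail)+
  have "emeasure (state_density D ?a) {..C} < \<infinity>"
    using assms C unfolding lower_attainable_def M_below_state_density[OF C, symmetric] by auto
  moreover have "emeasure (state_density D (\<lambda>u. M_tail C * s u)) {..C} < \<infinity>"
    using emeasure_state_density_cmult[OF continuous_s, of "{..C}" "M_tail C"] scale_below_finite[OF C]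
    by (simp add: M_tail_nonneg ennreal_mult_less_top)
  ultimately have fin: "emeasure (state_density D (\<lambda>u. ?a u + M_tail C * s u)) {..C} < \<infinity>"
    using emeasure_state_density_add[OF a(1) _ a(2), of "{..C}"]
    by (simp add: scale_density_pos less_imp_le M_tail_nonneg)
  have "emeasure (state_density D zeta') {..C}
      \<le> emeasure (state_density D (\<lambda>u. 2 * (?a u + M_tail C * s u))) {..C}"
  proof (rule emeasure_state_density_mono[OF continuous_zeta'])
    show "continuous_on S (\<lambda>u. 2 * (?a u + M_tail C * s u))"
      by (intro continuous_intros continuous_s continuous_M_tail)
    show "zeta' u \<le> 2 * (?a u + M_tail C * s u)" for u
    proof -
      have "M_tail u \<le> max 0 (M_tail u - M_tail C) + M_tail C" by linarith
      then have "M_tail u * s u \<le> (max 0 (M_tail u - M_tail C) + M_tail C) * s u"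
        by (rule mult_right_mono) (simp add: scale_density_pos less_imp_le)
      then show ?thesis by (simp add: zeta'_def distrib_right)
    qed
  qed simp
  also have "\<dots> = ennreal 2 * emeasure (state_density D (\<lambda>u. ?a u + M_tail C * s u)) {..C}"
    by (intro emeasure_state_density_cmult continuous_intros continuous_s continuous_M_tail) auto
  also have "\<dots> < \<infinity>" using fin by (simp add: ennreal_mult_less_top)
  finally show ?thesis .
qed

text \<open>Naturality yields some \<open>x\<close> for which the integral of \<open>M[u, x]\<close>
  diverges; \<open>M[u, b)\<close> is larger, and \<open>x\<close> can be exchanged for
  \<open>C\<close>.\<close>

lemma zeta'_below_top:
  assumes "lower_natural D"
  shows "emeasure (state_density D zeta') {..C} = \<infinity>"
proof -
  obtain x where x: "x \<in> S"
    and top: "emeasure (state_density D (\<lambda>u. max 0 (M_tail u - M_tail x) * s u)) {..x} = \<infinity>"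
    using assms M_below_state_density unfolding lower_natural_def lower_attainable_def
    by (auto simp: less_top[symmetric])
  have "emeasure (state_density D (\<lambda>u. max 0 (M_tail u - M_tail x) * s u)) {..x}
      \<le> emeasure (state_density D zeta') {..x}"
  proof (rule emeasure_state_density_mono[OF _ continuous_zeta'])
    show "continuous_on S (\<lambda>u. max 0 (M_tail u - M_tail x) * s u)"
      by (intro continuous_intros continuous_s continuous_M_tail)
    show "max 0 (M_tail u - M_tail x) * s u \<le> zeta' u" for u
      using mult_right_mono[of "max 0 (M_tail u - M_tail x)" "2 * M_tail u" "s u"]
        M_tail_nonneg[of u] M_tail_nonneg[of x]
      by (simp add: zeta'_def scale_density_pos less_imp_le)
  qed simp
  then have "emeasure (state_density D zeta') {..x} = \<infinity>" using top by (simp add: top_unique)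
  then show ?thesis
    using state_density_atMost_top[OF continuous_zeta' zeta'_nonneg x C] by simp
qed

text \<open>The diverging integral is at most \<open>M(a, x]\<close> times \<open>S(a, x]\<close>,
  and the second factor is finite since \<open>a\<close> is attracting.\<close>

lemma M_below_top:
  assumes "lower_natural D" "y \<in> S"
  shows "emeasure (state_density D m) {..y} = \<infinity>"
proof -
  obtain x where x: "x \<in> S"
    and top: "(\<integral>\<^sup>+u\<in>{..x}. emeasure (speed_measure D) {u..x} \<partial>scale_measure D) = \<infinity>"
    using assms unfolding lower_natural_def lower_attainable_def by (auto simp: less_top[symmetric])
  have "(\<integral>\<^sup>+u\<in>{..x}. emeasure (speed_measure D) {u..x} \<partial>scale_measure D)
      \<le> (\<integral>\<^sup>+u\<in>{..x}. emeasure (speed_measure D) {..x} \<partial>scale_measure D)"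
    by (intro nn_integral_mono) (auto simp: indicator_def speed_measure_eq intro!: emeasure_mono)
  also have "\<dots> = emeasure (speed_measure D) {..x} * emeasure (scale_measure D) {..x}"
    by (intro nn_integral_cmult_indicator) (simp add: scale_measure_eq)
  finally have "emeasure (speed_measure D) {..x} * emeasure (scale_measure D) {..x} = \<infinity>"
    using top by (simp add: top_unique)
  then have "emeasure (state_density D m) {..x} = \<infinity>"
    using scale_below_finite[OF x]
    by (auto simp: scale_measure_eq speed_measure_eq ennreal_mult_eq_top_iff less_top)
  then show ?thesis
    by (rule state_density_atMost_top[OF continuous_m _ x assms(2), rotated]) (simp add: m_pos less_imp_le)
qed

text \<open>Once \<open>c0 > K\<close> on all of \<open>[h, b)\<close>, every tail integral of the
  cost from \<open>u \<ge> h\<close> inherits the bound; both densities carry the same factor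
  \<open>s u\<close>.\<close>

lemma cost_dominates_near_upper:
  assumes "0 \<le> K"
  obtains h where "h \<in> S" "\<And>u. u \<in> S \<Longrightarrow> h \<le> u \<Longrightarrow> K * zeta' u \<le> g0' u"
proof -
  obtain l h where lh: "l \<in> S" "h \<in> S" "l < h" "\<And>x. x \<in> S \<Longrightarrow> x \<le> l \<or> h \<le> x \<Longrightarrow> K < c0 x"
    using c0_large by metis
  have "K * zeta' u \<le> g0' u" if u: "u \<in> S" "h \<le> u" for u
  proof -
    have "ennreal (2 * K) * emeasure (state_density D m) {u..}
        \<le> emeasure (state_density D (\<lambda>v. 2 * c0 v * m v)) {u..}"
      using lh(4) u(2) assms by (intro emeasure_cost_ge) (auto intro: less_imp_le)
    then have "ennreal (2 * K * M_tail u) \<le> ennreal (G_tail u)"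
      using u assms by (simp add: emeasure_M_tail emeasure_G_tail ennreal_mult M_tail_nonneg)
    then have "2 * K * M_tail u \<le> G_tail u" by (simp add: G_tail_nonneg)
    then have "2 * K * M_tail u * s u \<le> G_tail u * s u"
      by (intro mult_right_mono) (simp_all add: scale_density_pos less_imp_le)
    then show ?thesis by (simp add: zeta'_def g0'_def mult_ac)
  qed
  then show ?thesis using that lh(2) by blast
qed

text \<open>Since the speed measure is infinite near a natural left boundary, the average of \<open>c0\<close> over
  \<open>[u, b)\<close> is governed by the large values of \<open>c0\<close> close to \<open>a\<close>.\<close>

lemma cost_dominates_near_lower:
  assumes "lower_natural D" "0 \<le> K"
  obtains l where "l \<in> S" "\<And>u. u \<in> S \<Longrightarrow> u \<le> l \<Longrightarrow> K * zeta' u \<le> g0' u"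
proof -
  \<comment> \<open>The level is \<open>2 * K\<close> because the estimate below uses only the part
    of \<open>[u, b)\<close> up to \<open>l1\<close>, which will carry at least half of the
    mass.\<close>
  obtain l1 h1 where lh: "l1 \<in> S" "h1 \<in> S" "l1 < h1"
      "\<And>x. x \<in> S \<Longrightarrow> x \<le> l1 \<or> h1 \<le> x \<Longrightarrow> 2 * K < c0 x"
    using c0_large by metis
  \<comment> \<open>Infinite mass near \<open>a\<close> allows \<open>l\<close> such that
    \<open>[l, l1]\<close> outweighs the whole tail \<open>[l1, b)\<close>; every
    \<open>u \<le> l\<close> inherits this.\<close>
  have "ennreal (M_tail l1) < emeasure (state_density D m) {..l1}"
    using M_below_top[OF assms(1) lh(1)] by simp
  then obtain l where l: "l \<in> S" "l \<le> l1" "ennreal (M_tail l1) < emeasure (state_density D m) {l..l1}"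
    using state_density_approx_lower[OF lower_less_upper continuous_m lh(1)] by metis
  then have l2: "2 * M_tail l1 < M_tail l"
    using emeasure_M_Icc[OF l(1) lh(1) l(2)] by (simp add: M_tail_nonneg ennreal_less_iff)
  have "K * zeta' u \<le> g0' u" if u: "u \<in> S" "u \<le> l" for u
  proof -
    have ul: "u \<le> l1" using u l by simp
    have "ennreal (2 * (2 * K)) * emeasure (state_density D m) {u..l1}
        \<le> emeasure (state_density D (\<lambda>v. 2 * c0 v * m v)) {u..l1}"
      using lh(4) assms by (intro emeasure_cost_ge) (auto intro: less_imp_le)
    also have "\<dots> \<le> emeasure (state_density D (\<lambda>v. 2 * c0 v * m v)) {u..}"
      by (intro emeasure_mono) auto
    finally have "ennreal (2 * (2 * K)) * ennreal (M_tail u - M_tail l1) \<le> ennreal (G_tail u)"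
      using u by (simp add: emeasure_M_Icc[OF u(1) lh(1) ul] emeasure_G_tail)
    then have "ennreal (2 * (2 * K) * (M_tail u - M_tail l1)) \<le> ennreal (G_tail u)"
      using assms M_tail_antimono[OF u(1) ul] by (simp add: ennreal_mult)
    then have "2 * (2 * K) * (M_tail u - M_tail l1) \<le> G_tail u" by (simp add: G_tail_nonneg)
    moreover have "2 * K * M_tail u \<le> 2 * K * (2 * (M_tail u - M_tail l1))"
      using l2 M_tail_antimono[OF u] assms(2) by (intro mult_left_mono) auto
    ultimately have "2 * K * M_tail u \<le> G_tail u" by (simp add: algebra_simps)
    then have "2 * K * M_tail u * s u \<le> G_tail u * s u"
      by (intro mult_right_mono) (simp_all add: scale_density_pos less_imp_le)
    then show ?thesis by (simp add: zeta'_def g0'_def mult_ac)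
  qed
  then show ?thesis using that l(1) by blast
qed

lemma zeta'_above_finite:
  assumes "upper_entrance D"
  shows "emeasure (state_density D zeta') {C..} < \<infinity>"
proof -
  have "(\<integral>\<^sup>+u\<in>{C..}. emeasure (speed_measure D) {u..} \<partial>scale_measure D)
      = emeasure (state_density D (\<lambda>u. M_tail u * s u)) {C..}"
    unfolding scale_measure_eq speed_measure_eq
    by (intro nn_integral_state_density continuous_s continuous_M_tail)
      (simp_all add: scale_density_pos less_imp_le M_tail_nonneg emeasure_M_tail)
  then have "emeasure (state_density D (\<lambda>u. M_tail u * s u)) {C..} < \<infinity>"
    using assms C by (auto simp: upper_entrance_def)
  moreover have "emeasure (state_density D (\<lambda>u. 2 * (M_tail u * s u))) {C..}
      = ennreal 2 * emeasure (state_density D (\<lambda>u. M_tail u * s u)) {C..}"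
    by (intro emeasure_state_density_cmult continuous_intros continuous_s continuous_M_tail) auto
  ultimately show ?thesis
    by (simp add: zeta'_def[abs_def] mult.assoc ennreal_mult_less_top)
qed

text \<open>This is the divergence of the iterated cost integral, up to the factor 2 built into
  \<open>g0\<close>.\<close>

lemma g0'_above_top: "emeasure (state_density D g0') {C..} = \<infinity>"
proof -
  have "emeasure (state_density D (\<lambda>v. c0 v * m v)) {u..} = ennreal (G_tail u / 2)" if "u \<in> S" for u
    using emeasure_double_cost[of u] emeasure_G_tail[OF that]
    by (cases "emeasure (state_density D (\<lambda>v. c0 v * m v)) {u..}")
      (auto simp: ennreal_mult_top G_tail_nonneg ennreal_mult[symmetric] simp flip: ennreal_numeral)
  then have "(\<integral>\<^sup>+u\<in>{C..}. (\<integral>\<^sup>+v\<in>{u..}. ennreal (c0 v) \<partial>speed_measure D) \<partial>scale_measure D)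
      = emeasure (state_density D (\<lambda>u. G_tail u / 2 * s u)) {C..}"
    unfolding scale_measure_eq cost_tail_eq
    by (intro nn_integral_state_density continuous_s continuous_intros continuous_G_tail)
      (simp_all add: scale_density_pos less_imp_le G_tail_nonneg)
  then have "emeasure (state_density D (\<lambda>u. G_tail u / 2 * s u)) {C..} = \<infinity>"
    using c0 C by (simp add: holding_cost_condition_def)
  moreover have "emeasure (state_density D (\<lambda>u. G_tail u / 2 * s u)) {C..}
      \<le> emeasure (state_density D g0') {C..}"
    using G_tail_nonneg
    by (intro emeasure_state_density_mono continuous_g0' continuous_intros continuous_s continuous_G_tail)
      (auto simp: g0'_def scale_density_pos less_imp_le intro!: mult_right_mono)
  ultimately show ?thesis by (simp add: top_unique)
qed

lemma g_unbounded_above: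
  obtains h where "h \<in> S" "C \<le> h" "B < g h"
proof -
  obtain h where h: "h \<in> S" "C \<le> h" "ennreal B < emeasure (state_density D g0') {C..h}"
    using state_density_approx_upper[OF lower_less_upper continuous_g0' C, of "ennreal B"] g0'_above_top
    by auto
  have "enn2ereal (emeasure (state_density D g0') {C..h}) = ereal (g h)"
    using h(2) g0_eq[of h] g0_real[OF h(1)] by (simp add: signed_dist_def)
  then have "ennreal B < ennreal (g h)"
    using h(3) by (metis e2ennreal_enn2ereal e2ennreal_ereal)
  \<comment> \<open>A negative \<open>B\<close> is truncated to 0 by \<open>ennreal\<close>;
    monotonicity of \<open>ennreal\<close> still gives the strict inequality.\<close>
  then have "B < g h" by (meson ennreal_leI not_le)
  then show ?thesis using that h by blast
qed

lemma Z_unbounded_below: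
  assumes "lower_natural D"
  obtains l where "l \<in> S" "l \<le> C" "Z l < B"
proof -
  obtain l where l: "l \<in> S" "l \<le> C" "ennreal (- B) < emeasure (state_density D zeta') {l..C}"
    using state_density_approx_lower[OF lower_less_upper continuous_zeta' C, of "ennreal (- B)"]
      zeta'_below_top[OF assms]
    by auto
  \<comment> \<open>At \<open>l = C\<close> the definition of \<open>signed_dist\<close> takes its
    other branch. A single point has mass 0, so the strict bound excludes this.\<close>
  then have "l \<noteq> C"
    using emeasure_state_density_singleton[OF continuous_zeta'] by auto
  then have "- enn2ereal (emeasure (state_density D zeta') {l..C}) = ereal (Z l)"
    using l(2) zeta_eq[of l] zeta_real[OF l(1)] by (simp add: signed_dist_def)
  then have "enn2ereal (emeasure (state_density D zeta') {l..C}) = ereal (- Z l)"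
    by (metis ereal_uminus_uminus uminus_ereal.simps(1))
  then have "ennreal (- B) < ennreal (- Z l)"
    using l(3) by (metis e2ennreal_enn2ereal e2ennreal_ereal)
  then have "Z l < B" by (meson ennreal_leI neg_le_iff_le not_le)
  then show ?thesis using that l by blast
qed

section \<open>Adjoined boundaries and the pairs of finite cost\<close>

lemma estate_bounds: "x \<in> estate D \<Longrightarrow> lower D \<le> ereal x \<and> ereal x \<le> upper D"
  using lower_less_upper by (auto simp: estate_def state_def einterval_iff intro: less_imp_le)

lemma state_subset_estate: "S \<subseteq> estate D"
  by (auto simp: estate_def)

text \<open>Adjoined boundaries are extreme points of the state space. Derivative arguments can
  therefore run on open intervals whose ends may be boundaries.\<close>

lemma between_estate:
  assumes "y \<in> estate D" "z \<in> estate D" "y < x" "x < z"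
  shows "x \<in> S"
proof -
  have "lower D < ereal x" "ereal x < upper D"
    using estate_bounds[OF assms(1)] estate_bounds[OF assms(2)] assms(3,4)
    by (metis ereal_less_eq(3) le_less_trans less_ereal.simps(1), metis less_ereal.simps(1) less_le_trans)
  then show ?thesis by (simp add: state_def einterval_iff)
qed

lemma R_set_cases:
  assumes "(y, z) \<in> R_set D"
  obtains "y \<in> S" "z \<in> S" "y < z"
    | "ereal y = lower D" "lower_attainable D" "z \<in> S" "y < z"
    | "ereal z = upper D" "upper_entrance D" "y \<in> S" "y < z"
    | "ereal y = lower D" "lower_attainable D" "ereal z = upper D" "upper_entrance D" "y < z"
proof -
  have yz: "y \<in> estate D" "z \<in> estate D" "y < z" using assms by (auto simp: R_set_def)
  have "ereal y \<noteq> upper D" "ereal z \<noteq> lower D"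
    using estate_bounds[OF yz(1)] estate_bounds[OF yz(2)] yz(3) by (auto dest: sym)
  then show ?thesis using yz that by (auto simp: estate_def)
qed

lemma zeta_finite:
  assumes "x \<in> estate D"
  shows "zeta D C x = ereal (Z x)"
proof -
  have fin: "enn2ereal a = ereal (real_of_ereal (enn2ereal a))" if "a < \<infinity>" for a
    using that by (cases a) auto
  consider "x \<in> S" | "ereal x = lower D" "lower_attainable D" | "ereal x = upper D" "upper_entrance D"
    using assms by (auto simp: estate_def)
  then show ?thesis
  proof cases
    case 1
    then show ?thesis by (rule zeta_real)
  next
    case 2
    then show ?thesis
      using fin[OF zeta'_below_finite] unfolding Z_def zeta_eq
      by (metis signed_dist_lower[OF continuous_zeta' C] real_of_ereal.simps(1) uminus_ereal.simps(1))
  next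
    case 3
    then show ?thesis
      using fin[OF zeta'_above_finite] unfolding Z_def zeta_eq
      by (metis signed_dist_upper[OF continuous_zeta' C])
  qed
qed

text \<open>Derivatives are available only inside, so strictness comes from an interior pair
  \<open>p < q\<close>; monotonicity of the distribution function carries it to the endpoints. All
  denominators of \<open>F\<close> are thus positive.\<close>

lemma Z_strict_mono:
  assumes "y \<in> estate D" "z \<in> estate D" "y < z"
  shows "Z y < Z z"
proof -
  obtain p where p: "y < p" "p < z" using assms(3) dense by blast
  obtain q where q: "p < q" "q < z" using p(2) dense by blast
  have "Z p < Z q"
  proof (rule DERIV_pos_imp_increasing[OF q(1)])
    fix x assume "p \<le> x" "x \<le> q"
    then have "x \<in> S" using p q by (intro between_estate[OF assms(1,2)]) auto
    then show "\<exists>d. (Z has_real_derivative d) (at x) \<and> 0 < d" using Z_deriv zeta'_pos by blast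
  qed
  moreover have "p \<in> estate D" "q \<in> estate D"
    using between_estate[OF assms(1,2)] p q state_subset_estate by auto
  then have "Z y \<le> Z p" "Z q \<le> Z z"
    using zeta_mono[of y p] zeta_mono[of q z] p q assms by (simp_all add: zeta_finite)
  ultimately show ?thesis by linarith
qed

lemma Z_mono: "y \<in> estate D \<Longrightarrow> z \<in> estate D \<Longrightarrow> y \<le> z \<Longrightarrow> Z y \<le> Z z"
  using Z_strict_mono[of y z] by (cases "y = z") auto

lemma Z_mono_state: "y \<in> S \<Longrightarrow> z \<in> S \<Longrightarrow> y \<le> z \<Longrightarrow> Z y \<le> Z z"
  using Z_mono state_subset_estate by blast

lemma g_mono: "y \<in> S \<Longrightarrow> z \<in> S \<Longrightarrow> y \<le> z \<Longrightarrow> g y \<le> g z"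
  using g0_mono[of y z] by (simp add: g0_real)

lemma g0_upper: "ereal h = upper D \<Longrightarrow> g0 D c0 C h = \<infinity>"
  unfolding g0_eq by (simp add: signed_dist_upper[OF continuous_g0' C] g0'_above_top[simplified])

lemma g0_less_top: "(y, z) \<in> R_set D \<Longrightarrow> g0 D c0 C y < \<infinity>"
proof -
  assume "(y, z) \<in> R_set D"
  then have yz: "y \<in> estate D" "z \<in> estate D" "y < z" by (auto simp: R_set_def)
  obtain p where p: "y < p" "p < z" using yz(3) dense by blast
  then have "p \<in> S" using between_estate yz by blast
  then show ?thesis using g0_mono[of y p] p(1) by (auto simp: g0_real intro: le_less_trans)
qed

lemma g0_finite:
  assumes "(y, z) \<in> R_set D" "g0 D c0 C y \<noteq> -\<infinity>"
  shows "g0 D c0 C y = ereal (g y)"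
  using g0_less_top[OF assms(1)] assms(2) unfolding g_def by (cases "g0 D c0 C y") auto

lemma cost_F_eq:
  assumes R: "(y, z) \<in> R_set D" and z: "z \<in> S" and y: "g0 D c0 C y \<noteq> -\<infinity>"
  shows "cost_F D c0 c1 C (y, z) = ereal ((c1 (y, z) + g z - g y) / (Z z - Z y))"
proof -
  have "y \<in> estate D" "z \<in> estate D" "y < z" using R by (auto simp: R_set_def)
  then show ?thesis
    using Z_strict_mono[of y z]
    by (simp add: cost_F_def incr_def g0_finite[OF R y] g0_real[OF z] zeta_finite add_diff_eq)
qed

text \<open>The increment of \<open>g0\<close> is infinite in both cases, while that of
  \<open>zeta\<close> is finite and positive. A minimizer therefore has \<open>z\<close> interior
  and \<open>g0\<close> finite at \<open>y\<close>, and further computation with it is real.\<close>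

lemma cost_F_top:
  assumes R: "(y, z) \<in> R_set D" and "z \<notin> S \<or> g0 D c0 C y = -\<infinity>"
  shows "cost_F D c0 c1 C (y, z) = \<infinity>"
proof -
  have yz: "y \<in> estate D" "z \<in> estate D" "y < z" using R by (auto simp: R_set_def)
  have "g0 D c0 C z - g0 D c0 C y = \<infinity>"
    using R
  proof (cases rule: R_set_cases)
    case 3
    then show ?thesis using g0_upper[of z] g0_real[of y] by simp
  next
    case 4
    then show ?thesis using g0_upper[of z] g0_less_top[OF R] by (cases "g0 D c0 C y") auto
  qed (use assms(2) g0_real in auto)
  then show ?thesis
    using Z_strict_mono[OF yz] yz by (simp add: cost_F_def incr_def zeta_finite)
qed

lemma cost_F_finite:
  assumes R: "(y, z) \<in> R_set D" and "cost_F D c0 c1 C (y, z) < \<infinity>"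
  shows "z \<in> S" "g0 D c0 C y = ereal (g y)"
    "cost_F D c0 c1 C (y, z) = ereal ((c1 (y, z) + g z - g y) / (Z z - Z y))"
    "y \<in> S \<or> ereal y = lower D \<and> lower_attainable D"
proof -
  show z: "z \<in> S" using assms cost_F_top by fastforce
  have y: "g0 D c0 C y \<noteq> -\<infinity>" using assms cost_F_top by fastforce
  show "g0 D c0 C y = ereal (g y)" using R y by (rule g0_finite)
  show "cost_F D c0 c1 C (y, z) = ereal ((c1 (y, z) + g z - g y) / (Z z - Z y))"
    using R z y by (rule cost_F_eq)
  show "y \<in> S \<or> ereal y = lower D \<and> lower_attainable D"
    using R by (cases rule: R_set_cases) auto
qed

lemma isCont_Z: "x \<in> S \<Longrightarrow> isCont Z x" and isCont_g: "x \<in> S \<Longrightarrow> isCont g x"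
  using Z_deriv g_deriv DERIV_isCont by blast+

text \<open>The left end may be an attainable \<open>a\<close>. There \<open>Z\<close> has a finite
  limit but \<open>g0\<close> may tend to \<open>-\<infinity>\<close>, which is why one claim is
  about a real function and the other about an extended one.\<close>

lemma continuous_on_zeta_Icc:
  assumes l: "l \<in> S \<or> ereal l = lower D \<and> lower_attainable D" and h: "h \<in> S"
  shows "continuous_on {l..h} Z" "continuous_on {l..h} (g0 D c0 C)"
proof -
  have lE: "l \<in> estate D" using l by (auto simp: estate_def)
  have S: "x \<in> S" if "x \<in> {l..h}" "x \<noteq> l \<or> l \<in> S" for x
  proof (cases "l \<in> S")
    case True
    then show ?thesis using that h state_between[of l D h x] by auto
  next
    case False
    then show ?thesis using that h between_estate[OF lE, of h x] state_subset_estate by (cases "x = h") auto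
  qed
  have left: "(g0 D c0 C \<longlongrightarrow> g0 D c0 C l) (at l within {l..h})" "(Z \<longlongrightarrow> Z l) (at l within {l..h})"
    if "l \<notin> S"
  proof -
    have low: "ereal l = lower D" using l that by simp
    have le: "at l within {l..h} \<le> at_right l"
      by (auto simp: at_within_def intro!: le_infI2)
    show "(g0 D c0 C \<longlongrightarrow> g0 D c0 C l) (at l within {l..h})"
      using signed_dist_at_right_lower[OF continuous_g0' C low] le
      unfolding g0_eq[abs_def] by (rule tendsto_mono[rotated])
    have "(zeta D C \<longlongrightarrow> ereal (Z l)) (at_right l)"
      using signed_dist_at_right_lower[OF continuous_zeta' C low]
      unfolding zeta_finite[OF lE, symmetric] zeta_eq[abs_def] .
    then have "(Z \<longlongrightarrow> Z l) (at_right l)"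
      unfolding Z_def[abs_def] by (rule lim_real_of_ereal)
    then show "(Z \<longlongrightarrow> Z l) (at l within {l..h})" using le by (rule tendsto_mono[rotated])
  qed
  have int: "isCont (g0 D c0 C) x" if "x \<in> S" for x
  proof -
    have "isCont (\<lambda>x. ereal (g x)) x" using isCont_g[OF that] by (simp add: isCont_def)
    moreover have "\<forall>\<^sub>F y in nhds x. ereal (g y) = g0 D c0 C y"
      using eventually_nhds_in_open[OF open_state that] by eventually_elim (simp add: g0_real)
    ultimately show ?thesis by (subst (asm) isCont_cong)
  qed
  show "continuous_on {l..h} Z"
    unfolding continuous_on_def
  proof
    fix x assume "x \<in> {l..h}"
    then show "(Z \<longlongrightarrow> Z x) (at x within {l..h})"
      using S[of x] left(2) isCont_Z[of x]
      by (cases "x \<in> S") (auto simp: isCont_def intro: tendsto_within_subset[of _ _ _ UNIV])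
  qed
  show "continuous_on {l..h} (g0 D c0 C)"
    unfolding continuous_on_def
  proof
    fix x assume "x \<in> {l..h}"
    then show "(g0 D c0 C \<longlongrightarrow> g0 D c0 C x) (at x within {l..h})"
      using S[of x] left(1) int[of x]
      by (cases "x \<in> S") (auto simp: isCont_def intro: tendsto_within_subset[of _ _ _ UNIV])
  qed
qed

subsection \<open>Existence of a minimizer\<close>

lemma c1_lower_bound:
  obtains k where "0 < k" "\<And>p. p \<in> R_set D \<Longrightarrow> k \<le> c1 p"
proof -
  obtain k where "0 < k" "\<forall>p\<in>Rbar_set D. k \<le> c1 p"
    using c1 by (auto simp: ordering_cost_condition_def)
  then show ?thesis by (intro that[of k]) (auto simp: R_set_def Rbar_set_def)
qed

lemma continuous_c1: "continuous_on (Rbar_set D) c1"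
  using c1 by (simp add: ordering_cost_condition_def)

text \<open>The parameters serve the two ends. With \<open>K\<close> and \<open>- 1 / 2\<close>, the
  function \<open>H = K Z - g\<close> loses at least half the increment of \<open>g\<close>; with
  \<open>2 * K\<close> and \<open>- 1\<close> it loses at least \<open>K\<close> times the increment
  of \<open>Z\<close>.\<close>

lemma gap_mono:
  assumes "u \<in> S" "v \<in> S" "u \<le> v"
    and dom: "\<And>x. u \<le> x \<Longrightarrow> x \<le> v \<Longrightarrow> \<alpha> * zeta' x + \<beta> * g0' x \<le> 0"
  shows "\<alpha> * Z v + \<beta> * g v \<le> \<alpha> * Z u + \<beta> * g u"
proof (rule DERIV_nonpos_imp_nonincreasing[OF assms(3), of "\<lambda>x. \<alpha> * Z x + \<beta> * g x"])
  fix x assume x: "u \<le> x" "x \<le> v"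
  then have xS: "x \<in> S" using assms state_between by blast
  show "\<exists>d. ((\<lambda>x. \<alpha> * Z x + \<beta> * g x) has_real_derivative d) (at x) \<and> d \<le> 0"
    by (rule exI[of _ "\<alpha> * zeta' x + \<beta> * g0' x"])
      (use xS dom[OF x] in \<open>auto intro!: derivative_eq_intros Z_deriv g_deriv\<close>)
qed

lemma sublevel_bounded:
  assumes K: "0 < K" and k: "0 < k" "\<And>p. p \<in> R_set D \<Longrightarrow> k \<le> c1 p"
  obtains l h where "l \<in> S \<or> ereal l = lower D \<and> lower_attainable D" "h \<in> S"
    "\<And>y z. (y, z) \<in> R_set D \<Longrightarrow> cost_F D c0 c1 C (y, z) \<le> ereal K \<Longrightarrow>
      l \<le> y \<and> z \<le> h \<and> k / K \<le> Z z - Z y"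
proof -
  define H where "H x = K * Z x - g x" for x
  have level: "z \<in> S" "y \<in> S \<or> ereal y = lower D \<and> lower_attainable D"
      "g0 D c0 C y = ereal (g y)" "k \<le> H z - H y" "k / K \<le> Z z - Z y"
    if R: "(y, z) \<in> R_set D" and F: "cost_F D c0 c1 C (y, z) \<le> ereal K" for y z
  proof -
    have yz: "y \<in> estate D" "z \<in> estate D" "y < z" using R by (auto simp: R_set_def)
    have F': "cost_F D c0 c1 C (y, z) < \<infinity>" using F by (rule le_less_trans) simp
    note fin = cost_F_finite[OF R F']
    show zS: "z \<in> S" and "y \<in> S \<or> ereal y = lower D \<and> lower_attainable D"
      and gy: "g0 D c0 C y = ereal (g y)" using fin by auto
    have "c1 (y, z) + g z - g y \<le> K * (Z z - Z y)"
      using F fin(3) Z_strict_mono[OF yz] by (simp add: pos_divide_le_eq)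
    \<comment> \<open>Keeping the increment of \<open>g\<close> in the inequality gives the gap in
      \<open>H\<close>; dropping it, as it is nonnegative, gives the gap in
      \<open>Z\<close>.\<close>
    moreover have "g y \<le> g z" using g0_mono[of y z] yz(3) gy g0_real[OF zS] by simp
    ultimately have "k \<le> K * (Z z - Z y)" "k \<le> H z - H y"
      using k(2)[OF R] by (simp_all add: H_def algebra_simps)
    then show "k \<le> H z - H y" "k / K \<le> Z z - Z y" using K by (simp_all add: field_simps)
  qed
  obtain h1 where h1: "h1 \<in> S" "\<And>u. u \<in> S \<Longrightarrow> h1 \<le> u \<Longrightarrow> 2 * K * zeta' u \<le> g0' u"
    using cost_dominates_near_upper[of "2 * K"] K by auto
  obtain l0 where l0: "l0 \<in> S" "lower_natural D \<longrightarrow> (\<forall>u\<in>S. u \<le> l0 \<longrightarrow> 2 * K * zeta' u \<le> g0' u)"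
  proof (cases "lower_natural D")
    case True
    then obtain l where "l \<in> S" "\<And>u. u \<in> S \<Longrightarrow> u \<le> l \<Longrightarrow> 2 * K * zeta' u \<le> g0' u"
      using cost_dominates_near_lower[OF True, of "2 * K"] K by auto
    then show ?thesis by (intro that) auto
  next
    case False
    \<comment> \<open>With \<open>a\<close> attainable the condition on \<open>l0\<close> is
      vacuous, so any interior point serves.\<close>
    then show ?thesis using that C by blast
  qed
  \<comment> \<open>Taking the maximum with \<open>l0\<close> makes \<open>{l0..h0}\<close>
    nonempty, so \<open>H\<close> has a maximum on it.\<close>
  define h0 where "h0 = max h1 l0"
  have h0: "h0 \<in> S" "l0 \<le> h0" "\<And>u. u \<in> S \<Longrightarrow> h0 \<le> u \<Longrightarrow> 2 * K * zeta' u \<le> g0' u"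
    using h1(1) l0(1) by (simp add: h0_def max_def) (simp_all add: h0_def h1(2))
  have decr_upper: "H v \<le> H u - (g v - g u) / 2" if "u \<in> S" "v \<in> S" "h0 \<le> u" "u \<le> v" for u v
    using gap_mono[OF that(1,2,4), where \<alpha> = K and \<beta> = "- 1 / 2"] h0(3) that state_between[OF that(1,2)]
    by (fastforce simp: H_def field_simps)
  have decr_upper': "H v \<le> H u" if "u \<in> S" "v \<in> S" "h0 \<le> u" "u \<le> v" for u v
    using decr_upper[OF that] g_mono[OF that(1,2,4)] by argo
  have decr_lower: "H v \<le> H u - K * (Z v - Z u)"
    if "lower_natural D" "u \<in> S" "v \<in> S" "v \<le> l0" "u \<le> v" for u v
    using gap_mono[OF that(2,3,5), where \<alpha> = "2 * K" and \<beta> = "- 1"] l0(2) that state_between[OF that(2,3)]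
    by (fastforce simp: H_def field_simps)
  obtain l where l: "l \<in> S \<or> ereal l = lower D \<and> lower_attainable D"
    and l_le: "\<And>y z. (y, z) \<in> R_set D \<Longrightarrow> cost_F D c0 c1 C (y, z) \<le> ereal K \<Longrightarrow> l \<le> y"
  proof (cases "lower_natural D")
    case False
    then have att: "lower_attainable D" by (simp add: lower_natural_def)
    \<comment> \<open>Infinite boundaries are natural, so an attainable \<open>a\<close> is a real
      number and can itself be the left bound.\<close>
    then have "lower D \<noteq> -\<infinity>" using D by (auto simp: diffusion_condition_def lower_natural_def)
    moreover have "lower D \<noteq> \<infinity>" using lower_less_upper by auto
    ultimately obtain a where a: "ereal a = lower D" by (cases "lower D") auto
    have "a \<le> y" if "(y, z) \<in> R_set D" for y z
      using estate_bounds[of y] that by (simp add: R_set_def flip: a)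
    then show ?thesis using that[of a] a att by blast
  next
    case True
    have "continuous_on {l0..h0} H"
      unfolding H_def using Icc_subset_state[OF l0(1) h0(1)] isCont_Z isCont_g
      by (intro continuous_intros continuous_at_imp_continuous_on) blast+
    moreover have "{l0..h0} \<noteq> {}" using h0(2) by simp
    ultimately obtain w where w: "\<And>x. x \<in> {l0..h0} \<Longrightarrow> H x \<le> H w"
      using continuous_attains_sup[OF compact_Icc] by blast
    have Hw: "H z \<le> H w" if "z \<in> S" "l0 \<le> z" for z
    proof (cases "z \<le> h0")
      case True
      then show ?thesis using w that by simp
    next
      case False
      then have "H z \<le> H h0" using decr_upper'[OF h0(1) that(1)] by simp
      also have "\<dots> \<le> H w" using w h0(2) by simp
      finally show ?thesis .
    qed
    \<comment> \<open>For \<open>y\<close> below \<open>l\<close> and \<open>l0\<close>, the drop of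
      \<open>H\<close> from \<open>y\<close> to \<open>l0\<close> is at least
      \<open>K * (Z l0 - Z y)\<close>, hence at least \<open>H w - H l0\<close>. So
      \<open>H y\<close> is no smaller than any value of \<open>H\<close> to the right of
      \<open>l0\<close>.\<close>
    obtain l where l: "l \<in> S" "l \<le> C" "Z l < Z l0 - (H w - H l0) / K"
      using Z_unbounded_below[OF True] by metis
    have "min l l0 \<le> y" if R: "(y, z) \<in> R_set D" and F: "cost_F D c0 c1 C (y, z) \<le> ereal K" for y z
    proof (rule ccontr)
      assume "\<not> min l l0 \<le> y"
      then have y: "y < l" "y < l0" by auto
      note lev = level[OF R F]
      have yS: "y \<in> S" using lev(2) True by (simp add: lower_natural_def)
      have "y < z" using R by (simp add: R_set_def)
      have "H z \<le> H y"
      proof (cases "z \<le> l0")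
        case z: True
        have "0 \<le> K * (Z z - Z y)"
          using Z_mono_state[OF yS lev(1)] \<open>y < z\<close> K by simp
        then show ?thesis using decr_lower[OF True yS lev(1) z] \<open>y < z\<close> by simp
      next
        case False
        have "Z y \<le> Z l" using Z_mono_state[OF yS l(1)] y by simp
        then have "(H w - H l0) / K \<le> Z l0 - Z y" using l(3) by linarith
        then have "H w - H l0 \<le> K * (Z l0 - Z y)" using K by (simp add: pos_divide_le_eq mult.commute)
        then show ?thesis using decr_lower[OF True yS l0(1)] y Hw[of z] lev(1) False by simp
      qed
      then show False using lev(4) k(1) by simp
    qed
    moreover have "min l l0 \<in> S" using l(1) l0(1) by (simp add: min_def)
    ultimately show ?thesis using that by blast
  qed
  have lE: "l \<in> estate D" using l by (auto simp: estate_def)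
  \<comment> \<open>For \<open>l \<le> y \<le> h0\<close> monotonicity gives
    \<open>H y \<ge> K * Z l - g h0\<close>. \<open>B\<close> is the value of \<open>g h\<close> at
    which \<open>H h0\<close> minus half the increment of \<open>g\<close> over
    \<open>[h0, h]\<close> reaches that lower bound.\<close>
  define B where "B = g h0 + 2 * (H h0 - (K * Z l - g h0))"
  obtain h2 where h2: "h2 \<in> S" "B < g h2" using g_unbounded_above by metis
  define h where "h = max h0 h2"
  have h: "h \<in> S" "h0 \<le> h" "B \<le> g h"
    using h0(1) h2 g_mono[of h2 h0] by (auto simp: h_def max_def)
  have "z \<le> h" if R: "(y, z) \<in> R_set D" and F: "cost_F D c0 c1 C (y, z) \<le> ereal K" for y z
  proof (rule ccontr)
    assume "\<not> z \<le> h"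
    note lev = level[OF R F]
    have yz: "y \<in> estate D" "z \<in> estate D" "y < z" using R by (auto simp: R_set_def)
    have "H z \<le> H y"
    proof (cases "y \<le> h0")
      case True
      have "H z \<le> H h" using decr_upper'[OF h(1) lev(1) h(2)] \<open>\<not> z \<le> h\<close> by simp
      also have "\<dots> \<le> K * Z l - g h0"
        using decr_upper[OF h0(1) h(1) order_refl h(2)] h(3) by (simp add: B_def field_simps)
      also have "\<dots> \<le> H y"
      proof -
        have "g y \<le> g h0" using g0_mono[OF True] lev(3) g0_real[OF h0(1)] by simp
        moreover have "K * Z l \<le> K * Z y"
          using Z_mono[OF lE yz(1) l_le[OF R F]] K by simp
        ultimately show ?thesis by (simp add: H_def)
      qed
      finally show ?thesis .
    next
      case False
      then have "y \<in> S" using between_estate[OF _ yz(2), of h0 y] h0(1) state_subset_estate yz(3) by auto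
      then show ?thesis using decr_upper'[of y z] lev(1) False yz(3) by simp
    qed
    then show False using lev(4) k(1) by simp
  qed
  then show ?thesis using that[OF l h(1)] l_le level(5) by blast
qed

text \<open>\<open>F\<close> is a continuous real function plus a positive real multiple of
  \<open>- g0\<close> at the first component. As \<open>g0\<close> is never
  \<open>\<infinity>\<close> there, the sum has no indeterminate form, and it is continuous also
  where \<open>g0 = -\<infinity>\<close> and \<open>F = \<infinity>\<close>.\<close>

lemma cost_F_continuous:
  assumes l: "l \<in> S \<or> ereal l = lower D \<and> lower_attainable D" and h: "h \<in> S"
    and Q: "Q \<subseteq> {(y, z). l \<le> y \<and> y < z \<and> z \<le> h}"
  shows "continuous_on Q (cost_F D c0 c1 C)"
proof -
  have lE: "l \<in> estate D" using l by (auto simp: estate_def)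
  have in_S: "x \<in> S" if "l < x" "x \<le> h" for x
    using between_estate[OF lE, of h x] h state_subset_estate that by (cases "x = h") auto
  have R: "p \<in> R_set D" "snd p \<in> S" "fst p \<in> {l..h}" "snd p \<in> {l..h}" if p: "p \<in> Q" for p
  proof -
    obtain y z where "p = (y, z)" by (cases p)
    then have yz: "p = (y, z)" "l \<le> y" "y < z" "z \<le> h" using p Q by auto
    then have "z \<in> S" using in_S by simp
    moreover have "y \<in> estate D" using in_S[of y] yz lE state_subset_estate by (cases "y = l") auto
    ultimately show "p \<in> R_set D" "snd p \<in> S" "fst p \<in> {l..h}" "snd p \<in> {l..h}"
      using yz state_subset_estate by (auto simp: R_set_def)
  qed
  define \<delta> where "\<delta> p = Z (snd p) - Z (fst p)" for p
  have \<delta>: "0 < \<delta> p" if "p \<in> Q" for p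
    using R(1)[OF that] Z_strict_mono by (auto simp: \<delta>_def R_set_def)
  have Zc: "continuous_on Q (\<lambda>p. Z (fst p))" "continuous_on Q (\<lambda>p. Z (snd p))"
    by (rule continuous_on_compose2[OF continuous_on_zeta_Icc(1)[OF l h]]; use R in \<open>auto intro!: continuous_intros\<close>)+
  have gc: "continuous_on Q (\<lambda>p. g0 D c0 C (fst p))"
    by (rule continuous_on_compose2[OF continuous_on_zeta_Icc(2)[OF l h]]) (use R in \<open>auto intro!: continuous_intros\<close>)
  have gc2: "continuous_on Q (\<lambda>p. g (snd p))"
    by (rule continuous_on_compose2[of S]) (use R isCont_g in \<open>auto intro!: continuous_intros continuous_at_imp_continuous_on\<close>)
  have "continuous_on Q c1"
    using continuous_c1 by (rule continuous_on_subset) (use R(1) in \<open>force simp: R_set_def Rbar_set_def\<close>)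
  then have a: "continuous_on Q (\<lambda>p. (c1 p + g (snd p)) / \<delta> p)"
    using Zc gc2 \<delta> unfolding \<delta>_def by (intro continuous_intros) force+
  have b: "continuous_on Q (\<lambda>p. 1 / \<delta> p)"
    using Zc \<delta> unfolding \<delta>_def by (intro continuous_intros) force+
  have eq: "cost_F D c0 c1 C p = ereal ((c1 p + g (snd p)) / \<delta> p) + ereal (1 / \<delta> p) * - g0 D c0 C (fst p)"
    if "p \<in> Q" for p
  proof (cases "g0 D c0 C (fst p) = -\<infinity>")
    case True
    then show ?thesis using cost_F_top[of "fst p" "snd p"] R(1)[OF that] \<delta>[OF that] by simp
  next
    case False
    then show ?thesis
      using cost_F_eq[of "fst p" "snd p"] g0_finite[of "fst p" "snd p"] R[OF that]
      by (simp add: \<delta>_def diff_divide_distrib)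
  qed
  have "continuous_on Q (\<lambda>p. ereal ((c1 p + g (snd p)) / \<delta> p) + ereal (1 / \<delta> p) * - g0 D c0 C (fst p))"
    unfolding continuous_on_def
  proof
    fix p assume p: "p \<in> Q"
    have "((\<lambda>p. ereal (1 / \<delta> p) * - g0 D c0 C (fst p)) \<longlongrightarrow> ereal (1 / \<delta> p) * - g0 D c0 C (fst p)) (at p within Q)"
      using b gc p \<delta>[OF p] by (intro tendsto_mult_ereal tendsto_uminus_ereal tendsto_ereal) (auto simp: continuous_on_def)
    then show "((\<lambda>p. ereal ((c1 p + g (snd p)) / \<delta> p) + ereal (1 / \<delta> p) * - g0 D c0 C (fst p))
        \<longlongrightarrow> ereal ((c1 p + g (snd p)) / \<delta> p) + ereal (1 / \<delta> p) * - g0 D c0 C (fst p)) (at p within Q)"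
      using a p by (intro tendsto_add_ereal_general tendsto_ereal) (auto simp: continuous_on_def)
  qed
  then show ?thesis by (rule continuous_on_eq) (simp add: eq)
qed

lemma minimizer_exists:
  "\<exists>y z. (y, z) \<in> R_set D \<and> cost_F D c0 c1 C (y, z) = F_star D c0 c1 C"
proof -
  obtain k where k: "0 < k" "\<And>p. p \<in> R_set D \<Longrightarrow> k \<le> c1 p" using c1_lower_bound by metis
  obtain z0 where z0: "z0 \<in> S" "C < z0" using C by (rule state_greater)
  then have R0: "(C, z0) \<in> R_set D" using C by (auto simp: R_set_def estate_def)
  \<comment> \<open>The cost of one explicit interior pair, which makes the sublevel set
    nonempty.\<close>
  define K where "K = (c1 (C, z0) + g z0 - g C) / (Z z0 - Z C)"
  have F0: "cost_F D c0 c1 C (C, z0) = ereal K"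
    using cost_F_eq[OF R0 z0(1)] by (simp add: K_def g0_real[OF C])
  have K: "0 < K"
    using k(1) k(2)[OF R0] g_mono[OF C z0(1)] z0 Z_strict_mono[of C z0] C
    by (auto simp: K_def estate_def intro!: divide_pos_pos)
  obtain l h where l: "l \<in> S \<or> ereal l = lower D \<and> lower_attainable D" and h: "h \<in> S"
    and level: "\<And>y z. (y, z) \<in> R_set D \<Longrightarrow> cost_F D c0 c1 C (y, z) \<le> ereal K \<Longrightarrow>
      l \<le> y \<and> z \<le> h \<and> k / K \<le> Z z - Z y"
    using sublevel_bounded[OF K k] by metis
  \<comment> \<open>\<open>Q\<close> contains the pairs of cost at most \<open>K\<close> but need
    not equal their set. The closed condition on \<open>Z\<close> makes it compact and keeps it off
    the diagonal.\<close>
  define Q where "Q = {p \<in> {l..h} \<times> {l..h}. k / K \<le> Z (snd p) - Z (fst p)}"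
  have lE: "l \<in> estate D" and hE: "h \<in> estate D" using l h by (auto simp: estate_def)
  have E: "x \<in> estate D" if "l \<le> x" "x \<le> h" for x
    using between_estate[OF lE hE, of x] that lE hE state_subset_estate by (cases "x = l \<or> x = h") auto
  have QR: "p \<in> Q \<Longrightarrow> p \<in> R_set D \<and> fst p < snd p" for p
  proof -
    assume p: "p \<in> Q"
    then have "k / K \<le> Z (snd p) - Z (fst p)" by (simp add: Q_def)
    then have "0 < Z (snd p) - Z (fst p)" using divide_pos_pos[OF k(1) K] by linarith
    moreover have "fst p \<in> estate D" "snd p \<in> estate D" using p E by (auto simp: Q_def)
    ultimately have "fst p < snd p" using Z_mono[of "snd p" "fst p"] by (cases "snd p \<le> fst p") auto
    then show ?thesis using \<open>fst p \<in> estate D\<close> \<open>snd p \<in> estate D\<close> by (simp add: R_set_def split_beta)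
  qed
  have in_Q: "p \<in> Q" if "p \<in> R_set D" "cost_F D c0 c1 C p \<le> ereal K" for p
    using level[of "fst p" "snd p"] that by (cases p) (auto simp: Q_def R_set_def)
  have "compact Q"
  proof -
    have "continuous_on ({l..h} \<times> {l..h}) (\<lambda>p. Z (snd p) - Z (fst p))"
      by (intro continuous_intros; rule continuous_on_compose2[OF continuous_on_zeta_Icc(1)[OF l h]])
        (auto intro!: continuous_intros)
    then have "closed (({l..h} \<times> {l..h}) \<inter> (\<lambda>p. Z (snd p) - Z (fst p)) -` {k / K..})"
      by (rule continuous_closed_preimage) (auto intro: closed_Times)
    moreover have "Q = ({l..h} \<times> {l..h}) \<inter> (\<lambda>p. Z (snd p) - Z (fst p)) -` {k / K..}"
      by (auto simp: Q_def)
    moreover have "bounded Q"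
      by (rule bounded_subset[of "{l..h} \<times> {l..h}"]) (auto simp: Q_def bounded_Times)
    ultimately show ?thesis by (simp add: compact_eq_bounded_closed)
  qed
  moreover have Q0: "(C, z0) \<in> Q" using in_Q R0 F0 by simp
  moreover have "continuous_on Q (cost_F D c0 c1 C)"
    by (rule cost_F_continuous[OF l h]) (use QR in \<open>fastforce simp: Q_def\<close>)
  ultimately obtain p where p: "p \<in> Q" "\<And>q. q \<in> Q \<Longrightarrow> cost_F D c0 c1 C p \<le> cost_F D c0 c1 C q"
    using continuous_attains_inf[of Q "cost_F D c0 c1 C"] by blast
  \<comment> \<open>Outside \<open>Q\<close> the cost exceeds \<open>K\<close>, a value already
    attained in \<open>Q\<close> at \<open>(C, z0)\<close>.\<close>
  have "cost_F D c0 c1 C p \<le> cost_F D c0 c1 C q" if "q \<in> R_set D" for q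
    using p(2)[OF in_Q[OF that]] p(2)[OF Q0] F0 by (cases "cost_F D c0 c1 C q \<le> ereal K") auto
  then have "F_star D c0 c1 C = cost_F D c0 c1 C p"
    unfolding F_star_def using QR[OF p(1)] by (intro antisym INF_lower INF_greatest) auto
  then show ?thesis using QR[OF p(1)] by (metis prod.collapse)
qed

subsection \<open>First-order conditions\<close>

definition "rate \<equiv> real_of_ereal (F_star D c0 c1 C)"

text \<open>Clearing the positive denominator in \<open>F \<ge> F_star\<close> gives a function that
  is linear in \<open>g\<close> and \<open>Z\<close>, so no quotient has to be differentiated. The
  provisos on \<open>y'\<close> and \<open>z'\<close> exclude pairs of infinite cost, where
  \<open>g\<close> need not represent \<open>g0\<close>.\<close>

lemma minimizer:
  assumes R: "(y, z) \<in> R_set D" and min: "cost_F D c0 c1 C (y, z) = F_star D c0 c1 C"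
  shows "F_star D c0 c1 C = ereal rate" and "0 \<le> rate" and "z \<in> S" and "g0 D c0 C y = ereal (g y)"
    and "c1 (y, z) + g z - g y - rate * (Z z - Z y) = 0"
    and "\<And>y' z'. (y', z') \<in> R_set D \<Longrightarrow> z' \<in> S \<Longrightarrow> g0 D c0 C y' \<noteq> -\<infinity> \<Longrightarrow>
      0 \<le> c1 (y', z') + g z' - g y' - rate * (Z z' - Z y')"
proof -
  obtain z0 where z0: "z0 \<in> S" "C < z0" using C by (rule state_greater)
  then have R0: "(C, z0) \<in> R_set D" using C by (auto simp: R_set_def estate_def)
  have le: "F_star D c0 c1 C \<le> cost_F D c0 c1 C p" if "p \<in> R_set D" for p
    unfolding F_star_def using that by (rule INF_lower)
  have "F_star D c0 c1 C < \<infinity>"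
    using le[OF R0] cost_F_eq[OF R0 z0(1)] by (auto simp: g0_real[OF C] intro: le_less_trans)
  note fin = cost_F_finite[OF R, unfolded min, OF this]
  have Zpos: "0 < Z z' - Z y'" if "(y', z') \<in> R_set D" for y' z'
    using that Z_strict_mono by (auto simp: R_set_def)
  have rate: "rate = (c1 (y, z) + g z - g y) / (Z z - Z y)" by (simp add: rate_def fin(3))
  show F: "F_star D c0 c1 C = ereal rate" using fin(3) rate by simp
  show "z \<in> S" and gy: "g0 D c0 C y = ereal (g y)" using fin(1,2) .
  obtain k where "0 < k" "\<And>p. p \<in> R_set D \<Longrightarrow> k \<le> c1 p" using c1_lower_bound by metis
  then have "0 \<le> c1 (y, z)" using R by fastforce
  moreover have "g y \<le> g z"
    using g0_mono[of y z] R gy g0_real[OF fin(1)] by (simp add: R_set_def)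
  ultimately show "0 \<le> rate" using Zpos[OF R] by (simp add: rate)
  show "c1 (y, z) + g z - g y - rate * (Z z - Z y) = 0"
    using Zpos[OF R] by (simp add: rate)
  show "0 \<le> c1 (y', z') + g z' - g y' - rate * (Z z' - Z y')"
    if R': "(y', z') \<in> R_set D" "z' \<in> S" "g0 D c0 C y' \<noteq> -\<infinity>" for y' z'
    using le[OF R'(1)] Zpos[OF R'(1)] unfolding cost_F_eq[OF R'] F
    by (simp add: pos_le_divide_eq)
qed

text \<open>\<open>z\<close> is interior at every minimizer, even when \<open>y\<close> is the
  boundary, so this condition is an equality throughout. Sections in the second variable are
  neighbourhoods of \<open>z\<close>, which turns \<open>c1z\<close> into a two-sided
  derivative.\<close>

lemma first_order_z:
  assumes C1: "C1_with_partials D c1 c1y c1z"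
    and R: "(y, z) \<in> R_set D" and min: "cost_F D c0 c1 C (y, z) = F_star D c0 c1 C"
  shows "F_star D c0 c1 C = ereal ((c1z (y, z) + ederiv (g0 D c0 C) z) / ederiv (zeta D C) z)"
proof -
  note F = minimizer(1,2)[OF R min] and z = minimizer(3)[OF R min] and y = minimizer(4)[OF R min]
    and eq = minimizer(5)[OF R min] and ge = minimizer(6)[OF R min]
  have yz: "y \<in> estate D" "y < z" using R by (auto simp: R_set_def)
  let ?U = "S \<inter> {y<..}"
  have U: "open ?U" "z \<in> ?U" using open_state z yz by auto
  have UR: "(y, u) \<in> R_set D" if "u \<in> ?U" for u
    using that yz by (auto simp: R_set_def estate_def)
  have "((\<lambda>u. c1 (y, u)) has_real_derivative c1z (y, z)) (at z within {u. (y, u) \<in> R_set D})"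
    using C1 R unfolding C1_with_partials_def by auto
  then have "((\<lambda>u. c1 (y, u)) has_real_derivative c1z (y, z)) (at z)"
    using at_within_open_subset[OF U(2,1), of "{u. (y, u) \<in> R_set D}"] UR by (simp add: subset_iff)
  then have deriv: "((\<lambda>u. c1 (y, u) + g u - g y - rate * (Z u - Z y)) has_real_derivative
      c1z (y, z) + g0' z - rate * zeta' z) (at z)"
    using g_deriv[OF z] Z_deriv[OF z] by (auto intro!: derivative_eq_intros)
  obtain d where d: "0 < d" "ball z d \<subseteq> ?U" using U open_contains_ball by blast
  have "c1z (y, z) + g0' z - rate * zeta' z = 0"
  proof (rule DERIV_local_min[OF deriv d(1)], intro allI impI)
    fix u assume "\<bar>z - u\<bar> < d"
    then have "u \<in> ?U" using d(2) by (auto simp: subset_iff dist_real_def)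
    then show "c1 (y, z) + g z - g y - rate * (Z z - Z y) \<le> c1 (y, u) + g u - g y - rate * (Z u - Z y)"
      using ge[OF UR] eq y by auto
  qed
  then have "rate = (c1z (y, z) + g0' z) / zeta' z" using zeta'_pos[OF z] by (simp add: field_simps)
  then show ?thesis using F by (simp add: ederiv_g0[OF z] ederiv_zeta[OF z])
qed

lemma c1_partial_y:
  assumes C1: "C1_with_partials D c1 c1y c1z" and R: "(y, z) \<in> R_set D" and y: "y \<in> S"
  shows "((\<lambda>u. c1 (u, z)) has_real_derivative c1y (y, z)) (at y)"
proof -
  have yz: "z \<in> estate D" "y < z" using R by (auto simp: R_set_def)
  have U: "open (S \<inter> {..<z})" "y \<in> S \<inter> {..<z}" using open_state y yz by auto
  moreover have "S \<inter> {..<z} \<subseteq> {u. (u, z) \<in> R_set D}"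
    using yz by (auto simp: R_set_def estate_def)
  moreover have "((\<lambda>u. c1 (u, z)) has_real_derivative c1y (y, z)) (at y within {u. (u, z) \<in> R_set D})"
    using C1 R unfolding C1_with_partials_def by auto
  ultimately show ?thesis using at_within_open_subset by metis
qed

lemma first_order_y:
  assumes C1: "C1_with_partials D c1 c1y c1z"
    and R: "(y, z) \<in> R_set D" and min: "cost_F D c0 c1 C (y, z) = F_star D c0 c1 C"
    and y: "y \<in> S"
  shows "F_star D c0 c1 C = ereal ((- c1y (y, z) + ederiv (g0 D c0 C) y) / ederiv (zeta D C) y)"
proof -
  note F = minimizer(1,2)[OF R min] and z = minimizer(3)[OF R min]
    and eq = minimizer(5)[OF R min] and ge = minimizer(6)[OF R min]
  have yz: "z \<in> estate D" "y < z" using R by (auto simp: R_set_def)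
  let ?U = "S \<inter> {..<z}"
  have U: "open ?U" "y \<in> ?U" using open_state y yz by auto
  have deriv: "((\<lambda>u. c1 (u, z) + g z - g u - rate * (Z z - Z u)) has_real_derivative
      c1y (y, z) - g0' y + rate * zeta' y) (at y)"
    using c1_partial_y[OF C1 R y] g_deriv[OF y] Z_deriv[OF y] by (auto intro!: derivative_eq_intros)
  obtain d where d: "0 < d" "ball y d \<subseteq> ?U" using U open_contains_ball by blast
  have "c1y (y, z) - g0' y + rate * zeta' y = 0"
  proof (rule DERIV_local_min[OF deriv d(1)], intro allI impI)
    fix u assume "\<bar>y - u\<bar> < d"
    then have u: "u \<in> ?U" using d(2) by (auto simp: subset_iff dist_real_def)
    then have "(u, z) \<in> R_set D" using yz by (auto simp: R_set_def estate_def)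
    then show "c1 (y, z) + g z - g y - rate * (Z z - Z y) \<le> c1 (u, z) + g z - g u - rate * (Z z - Z u)"
      using ge[OF _ z] eq u g0_real[of u] by auto
  qed
  then have "rate = (- c1y (y, z) + g0' y) / zeta' y" using zeta'_pos[OF y] by (simp add: field_simps)
  then show ?thesis using F by (simp add: ederiv_g0[OF y] ederiv_zeta[OF y])
qed

text \<open>Moving \<open>y\<close> to the right keeps the pair admissible, so the function
  vanishing at the minimizer has nonnegative right difference quotients. They are real, as
  \<open>g0\<close> is finite at \<open>y\<close>, but their limits may be infinite; the conditions
  on \<open>dg\<close> and \<open>dz\<close> make the final division meaningful.\<close>

lemma boundary_right_derivatives:
  assumes C1: "C1_with_partials D c1 c1y c1z"
    and R: "(y, z) \<in> R_set D" and min: "cost_F D c0 c1 C (y, z) = F_star D c0 c1 C"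
    and dg: "has_right_ederiv (g0 D c0 C) dg y" and dz: "has_right_ederiv (zeta D C) dz y"
    and pos: "0 < dz" and det: "\<not> (dg = \<infinity> \<and> dz = \<infinity>)"
  shows "(ereal (- c1y (y, z)) + dg) / dz \<le> F_star D c0 c1 C"
proof -
  note F = minimizer(1,2)[OF R min] and z = minimizer(3)[OF R min] and y = minimizer(4)[OF R min]
    and eq = minimizer(5)[OF R min] and ge = minimizer(6)[OF R min]
  have yz: "y \<in> estate D" "z \<in> estate D" "y < z" using R by (auto simp: R_set_def)
  have mem: "u \<in> S \<and> (u, z) \<in> R_set D" if "u \<in> {y<..<z}" for u
    using between_estate[OF yz(1,2), of u] that yz by (auto simp: R_set_def estate_def)
  have near: "\<forall>\<^sub>F u in at_right y. u \<in> {y<..<z}"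
    by (rule eventually_at_right_real[OF yz(3)])
  have "((\<lambda>u. c1 (u, z)) has_real_derivative c1y (y, z)) (at y within {u. (u, z) \<in> R_set D})"
    using C1 R unfolding C1_with_partials_def by auto
  \<comment> \<open>The midpoint keeps the interval below \<open>z\<close>, hence inside the
    section; a derivative within such an interval at its left end is a right derivative.\<close>
  then have "((\<lambda>u. c1 (u, z)) has_real_derivative c1y (y, z)) (at y within {y..(y + z) / 2})"
  proof (rule DERIV_subset)
    show "{y..(y + z) / 2} \<subseteq> {u. (u, z) \<in> R_set D}"
    proof
      fix u assume "u \<in> {y..(y + z) / 2}"
      then show "u \<in> {u. (u, z) \<in> R_set D}" using mem[of u] R yz(3) by (cases "u = y") auto
    qed
  qed
  then have "((\<lambda>u. (c1 (u, z) - c1 (y, z)) / (u - y)) \<longlongrightarrow> c1y (y, z)) (at_right y)"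
    using yz(3) by (simp add: has_field_derivative_iff at_within_Icc_at_right)
  then have "((\<lambda>u. ereal (- ((c1 (u, z) - c1 (y, z)) / (u - y)))) \<longlongrightarrow> ereal (- c1y (y, z))) (at_right y)"
    by (intro tendsto_ereal tendsto_minus)
  then have lim1: "((\<lambda>u. ereal (- ((c1 (u, z) - c1 (y, z)) / (u - y)))
      + (g0 D c0 C u - g0 D c0 C y) / ereal (u - y)) \<longlongrightarrow> ereal (- c1y (y, z)) + dg) (at_right y)"
    using dg unfolding has_right_ederiv_def by (intro tendsto_add_ereal_general) auto
  have lim2: "((\<lambda>u. ereal rate * ((zeta D C u - zeta D C y) / ereal (u - y))) \<longlongrightarrow> ereal rate * dz) (at_right y)"
    using dz unfolding has_right_ederiv_def by (intro tendsto_cmult_ereal) auto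
  have "\<forall>\<^sub>F u in at_right y. ereal (- ((c1 (u, z) - c1 (y, z)) / (u - y)))
      + (g0 D c0 C u - g0 D c0 C y) / ereal (u - y)
      \<le> ereal rate * ((zeta D C u - zeta D C y) / ereal (u - y))"
    using near
  proof eventually_elim
    fix u assume u: "u \<in> {y<..<z}"
    then have uS: "u \<in> S" and uR: "(u, z) \<in> R_set D" using mem by auto
    have "- (c1 (u, z) - c1 (y, z)) + (g u - g y) \<le> rate * (Z u - Z y)"
      using ge[OF uR z] g0_real[OF uS] eq by (simp add: algebra_simps)
    then have "(- (c1 (u, z) - c1 (y, z)) + (g u - g y)) / (u - y) \<le> rate * (Z u - Z y) / (u - y)"
      using u by (intro divide_right_mono) auto
    then have "- ((c1 (u, z) - c1 (y, z)) / (u - y)) + (g u - g y) / (u - y) \<le> rate * ((Z u - Z y) / (u - y))"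
      by (simp add: add_divide_distrib diff_divide_distrib right_diff_distrib)
    then show "ereal (- ((c1 (u, z) - c1 (y, z)) / (u - y)))
      + (g0 D c0 C u - g0 D c0 C y) / ereal (u - y)
      \<le> ereal rate * ((zeta D C u - zeta D C y) / ereal (u - y))"
      using u by (simp add: g0_real[OF uS] y zeta_real[OF uS] zeta_finite[OF yz(1)])
  qed
  then have "ereal (- c1y (y, z)) + dg \<le> ereal rate * dz"
    using lim1 lim2 by (intro tendsto_le[OF _ lim2 lim1]) auto
  then show ?thesis unfolding F(1) using pos det F(2) by (intro ereal_divide_le_of_le_mult) auto
qed

text \<open>If the quotient stayed above \<open>F_star\<close> just to the right of
  \<open>y\<close>, the nonnegative function \<open>\<psi>\<close> would strictly decrease from its
  value 0 at \<open>y\<close>. Only right continuity at \<open>y\<close> enters, no derivative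
  there, so an irregular scale density at \<open>a\<close> does no harm.\<close>

lemma boundary_Liminf:
  assumes C1: "C1_with_partials D c1 c1y c1z"
    and R: "(y, z) \<in> R_set D" and min: "cost_F D c0 c1 C (y, z) = F_star D c0 c1 C"
  shows "Liminf (at_right y)
      (\<lambda>u. ereal ((- c1y (u, z) + ederiv (g0 D c0 C) u) / ederiv (zeta D C) u)) \<le> F_star D c0 c1 C"
proof (rule ccontr)
  let ?q = "\<lambda>u. ereal ((- c1y (u, z) + ederiv (g0 D c0 C) u) / ederiv (zeta D C) u)"
  assume "\<not> Liminf (at_right y) ?q \<le> F_star D c0 c1 C"
  then have "F_star D c0 c1 C < Liminf (at_right y) ?q" by simp
  then have ev: "\<forall>\<^sub>F u in at_right y. F_star D c0 c1 C < ?q u" by (rule less_LiminfD)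
  note F = minimizer(1,2)[OF R min] and z = minimizer(3)[OF R min] and y = minimizer(4)[OF R min]
    and eq = minimizer(5)[OF R min] and ge = minimizer(6)[OF R min]
  have yz: "y \<in> estate D" "z \<in> estate D" "y < z" using R by (auto simp: R_set_def)
  have mem: "u \<in> S \<and> (u, z) \<in> R_set D" if "u \<in> {y<..<z}" for u
    using between_estate[OF yz(1,2), of u] that yz by (auto simp: R_set_def estate_def)
  obtain b where b: "y < b" "\<And>u. y < u \<Longrightarrow> u < b \<Longrightarrow> F_star D c0 c1 C < ?q u"
    using ev unfolding eventually_at_right_field by auto
  define w where "w = (y + min b z) / 2"
  have w: "y < w" "w < b" "w < z" using b(1) yz(3) by (auto simp: w_def min_def)
  have wS: "w \<in> S" using mem w by auto
  have low: "y \<in> S \<or> ereal y = lower D \<and> lower_attainable D"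
    using R by (cases rule: R_set_cases) auto
  define \<psi> where "\<psi> u = c1 (u, z) + g z - g u - rate * (Z z - Z u)" for u
  have "continuous_on {y..w} \<psi>"
  proof -
    have "continuous_on {y..w} (\<lambda>u. c1 (u, z))"
    proof (rule continuous_on_compose2[OF continuous_c1])
      show "(\<lambda>u. (u, z)) ` {y..w} \<subseteq> Rbar_set D"
        using mem w yz by (force simp: Rbar_set_def R_set_def order_le_less)
    qed (intro continuous_intros)
    moreover have "continuous_on {y..w} g"
      unfolding continuous_on_def
    proof
      fix x assume x: "x \<in> {y..w}"
      \<comment> \<open>At \<open>x = y\<close> finiteness holds because \<open>y\<close> belongs to
        a minimizer; elsewhere \<open>x\<close> is interior.\<close>
      have "g0 D c0 C x = ereal (g x)"
        using x mem[of x] w y g0_real by (cases "x = y") auto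
      then show "(g \<longlongrightarrow> g x) (at x within {y..w})"
        using continuous_on_zeta_Icc(2)[OF low wS] x
        unfolding g_def[abs_def] continuous_on_def by (intro lim_real_of_ereal) auto
    qed
    ultimately show ?thesis
      unfolding \<psi>_def using continuous_on_zeta_Icc(1)[OF low wS] by (intro continuous_intros) auto
  qed
  then have "\<psi> w < \<psi> y"
  proof (rule DERIV_neg_imp_decreasing_open[OF w(1), rotated])
    fix u assume u: "y < u" "u < w"
    then have uS: "u \<in> S" and uR: "(u, z) \<in> R_set D" using mem[of u] w by auto
    have "rate < (- c1y (u, z) + g0' u) / zeta' u"
      using b(2)[of u] u w F by (simp add: ederiv_g0[OF uS] ederiv_zeta[OF uS])
    then have "c1y (u, z) - g0' u + rate * zeta' u < 0"
      using zeta'_pos[OF uS] by (simp add: pos_less_divide_eq)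
    moreover have "(\<psi> has_real_derivative c1y (u, z) - g0' u + rate * zeta' u) (at u)"
      unfolding \<psi>_def using c1_partial_y[OF C1 uR uS] g_deriv[OF uS] Z_deriv[OF uS]
      by (auto intro!: derivative_eq_intros)
    ultimately show "\<exists>d. (\<psi> has_real_derivative d) (at u) \<and> d < 0" by blast
  qed
  moreover have "\<psi> y = 0" using eq by (simp add: \<psi>_def)
  moreover have "0 \<le> \<psi> w" using ge[of w z] mem[of w] w z g0_real[OF wS] by (simp add: \<psi>_def)
  ultimately show False by simp
qed

end

theorem proposition3p5:
  fixes D :: diffusion
    and c0 :: "real \<Rightarrow> real"
    and c1 :: "real \<times> real \<Rightarrow> real"
    and C :: real
  assumes "diffusion_condition D"
    and "holding_cost_condition D c0"
    and "ordering_cost_condition D c1"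
    and "C \<in> state D"
  shows "(\<exists>y z. (y, z) \<in> R_set D \<and> cost_F D c0 c1 C (y, z) = F_star D c0 c1 C) \<and>
    (\<forall>c1y c1z. C1_with_partials D c1 c1y c1z \<longrightarrow>
      (\<forall>y z. (y, z) \<in> R_set D \<and> cost_F D c0 c1 C (y, z) = F_star D c0 c1 C \<longrightarrow>
        (lower_natural D \<longrightarrow>
          F_star D c0 c1 C
            = ereal ((- c1y (y, z) + ederiv (g0 D c0 C) y) / ederiv (zeta D C) y) \<and>
          F_star D c0 c1 C
            = ereal ((c1z (y, z) + ederiv (g0 D c0 C) z) / ederiv (zeta D C) z)) \<and>
        (lower_attainable D \<longrightarrow>
          (ereal y \<noteq> lower D \<longrightarrow>
            F_star D c0 c1 C
              = ereal ((- c1y (y, z) + ederiv (g0 D c0 C) y) / ederiv (zeta D C) y) \<and>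
            F_star D c0 c1 C
              = ereal ((c1z (y, z) + ederiv (g0 D c0 C) z) / ederiv (zeta D C) z)) \<and>
          (ereal y = lower D \<longrightarrow>
            (\<forall>dg dz. has_right_ederiv (g0 D c0 C) dg y \<and> has_right_ederiv (zeta D C) dz y \<and>
               0 < dz \<and> \<not> (dg = \<infinity> \<and> dz = \<infinity>) \<longrightarrow>
               (ereal (- c1y (y, z)) + dg) / dz \<le> F_star D c0 c1 C) \<and>
            Liminf (at_right y)
              (\<lambda>u. ereal ((- c1y (u, z) + ederiv (g0 D c0 C) u) / ederiv (zeta D C) u))
              \<le> F_star D c0 c1 C \<and>
            F_star D c0 c1 C
              = ereal ((c1z (y, z) + ederiv (g0 D c0 C) z) / ederiv (zeta D C) z)))))"
proof -
  interpret inventory_problem D c0 c1 C using assms by unfold_locales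
  show ?thesis
  proof (rule conjI[OF minimizer_exists], intro allI impI, goal_cases)
    case (1 c1y c1z y z)
    then have R: "(y, z) \<in> R_set D" and min: "cost_F D c0 c1 C (y, z) = F_star D c0 c1 C" by auto
    \<comment> \<open>A natural \<open>a\<close> is not adjoined to the state space, and
      \<open>y < z\<close> keeps \<open>y\<close> away from \<open>b\<close>, so only an attainable
      \<open>a\<close> could be a noninterior first component.\<close>
    have y: "y \<in> S" if "lower_natural D \<or> ereal y \<noteq> lower D"
      using R that by (cases rule: R_set_cases) (auto simp: lower_natural_def)
    show ?case
      using y first_order_y[OF 1(1) R min] first_order_z[OF 1(1) R min]
        boundary_right_derivatives[OF 1(1) R min] boundary_Liminf[OF 1(1) R min]
      by (intro conjI allI impI) simp_all
  qed
qed

end
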